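(* Let $\mathcal P=(X,\prec)$ be a poset with $|X|=n$ elements, and let $\omega:X\to\mathbb R_{>0}$ be a positive order-reversing weight function, i.e. $x\preccurlyeq y$ implies $\omega(x)\ge\omega(y)$. Fix an element $z\in X$. Then, for every $1<k<n$, $$\mathrm N_\omega(k)^2\ \ge\ \mathrm N_\omega(k-1)\cdot \mathrm N_\omega(k+1).$$
   Context: A linear extension of $\mathcal P$ is a bijection $L:X\to\{1,\dots,n\}$ with $L(x)<L(y)$ whenever $x\prec y$. Let $\mathcal E_k$ be the set of linear extensions $L$ with $L(z)=k$. For a linear extension $L$ put $\omega(L)=\prod_{x:\,L(x)<L(z)}\omega(x)$, and $\mathrm N_\omega(k)=\sum_{L\in\mathcal E_k}\omega(L)$ for $1\le k\le n$. *)

theory Defs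
  imports Complex_Main "HOL-Library.FuncSet"
begin

text \<open>
  A poset with ground set \<open>X\<close> is given by its reflexive order relation \<open>r\<close> with
  \<open>partial_order_on X r\<close>; the strict relation is \<open>(x, y) \<in> r \<and> x \<noteq> y\<close>.
  Linear extensions are extensional functions (equal to \<open>undefined\<close> outside \<open>X\<close>), so that
  each bijection of \<open>X\<close> onto \<open>{1..card X}\<close> is represented by exactly one HOL function and
  the set of linear extensions is finite.
\<close>

definition linear_extensions :: "'a set \<Rightarrow> 'a rel \<Rightarrow> ('a \<Rightarrow> nat) set" where
  "linear_extensions X r =
     {L \<in> X \<rightarrow>\<^sub>E {1..card X}.
        bij_betw L X {1..card X} \<and>
        (\<forall>x\<in>X. \<forall>y\<in>X. (x, y) \<in> r \<and> x \<noteq> y \<longrightarrow> L x < L y)}"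

definition linear_extensions_at :: "'a set \<Rightarrow> 'a rel \<Rightarrow> 'a \<Rightarrow> nat \<Rightarrow> ('a \<Rightarrow> nat) set" where
  "linear_extensions_at X r z k = {L \<in> linear_extensions X r. L z = k}"

definition extension_weight :: "'a set \<Rightarrow> ('a \<Rightarrow> real) \<Rightarrow> 'a \<Rightarrow> ('a \<Rightarrow> nat) \<Rightarrow> real" where
  "extension_weight X \<omega> z L = (\<Prod>x\<in>{x \<in> X. L x < L z}. \<omega> x)"

definition weighted_count ::
    "'a set \<Rightarrow> 'a rel \<Rightarrow> ('a \<Rightarrow> real) \<Rightarrow> 'a \<Rightarrow> nat \<Rightarrow> real" where
  "weighted_count X r \<omega> z k =
     (\<Sum>L\<in>linear_extensions_at X r z k. extension_weight X \<omega> z L)"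

end

theory Submission
  imports Defs "HOL-Analysis.Function_Topology"
begin

text \<open>
  The proof is by the combinatorial atlas method of Chan and Pak. A linear extension is read from
  both ends as a word of letters, each recording which element is removed and on which side of
  \<open>z\<close> it lies. For a subset \<open>S\<close> of the poset containing \<open>z\<close>, the matrix \<open>C\<close> counts the
  extensions of \<open>S\<close> by their first two letters, so that evaluating its bilinear form \<open>B\<close> at the
  two indicator vectors of the sides yields \<open>N (k - 1)\<close>, \<open>N k\<close> and \<open>N (k + 1)\<close>. The inequality
  is then the reversed Cauchy-Schwarz inequality for \<open>B\<close>, i.e. that \<open>B\<close> has at most one positive
  eigenvalue. This is proved by induction on the size of \<open>S\<close>: a row of a convex combination
  of the matrices for two consecutive positions is a value of the form for \<open>S\<close> with one
  element removed, and the inductive reversed Cauchy-Schwarz inequality for the rows forces every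
  positive eigenvalue, suitably normalised, to be at least 1, which is the Perron eigenvalue; that
  one is simple because the matrix is irreducible. The pure matrices are limits of the
  combinations. Monotonicity of the weight enters only when \<open>S\<close> has three elements.
\<close>

section \<open>Hyperbolic forms\<close>

text \<open>Two facts about the quadratic forms \<open>q i\<close> of the rows drive the eigenvalue
  bound. The inductive inequality bounds \<open>q i v\<close> by the squared \<open>i\<close>-th
  entry of \<open>M v\<close> divided by that of \<open>M h\<close>, and the pullback inequality
  \<open>C_pull\<close> bounds the form of \<open>M\<close> by the \<open>h\<close>-weighted sum of
  the \<open>q i\<close>. Together they say \<open><v, T v> <= <T v, T v>\<close> for
  \<open>T = D^-1 M\<close>, where the diagonal matrix \<open>D\<close> is chosen so that
  \<open>T h = h\<close> and the inner product is weighted by \<open>D\<close>; on an eigenvector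
  this reads \<open>lam <= lam^2\<close>. Mixing is forced by the vector \<open>h\<close>. Reading a
  letter below \<open>z\<close> lowers the position of \<open>z\<close> by one, reading a letter
  above keeps it, so a pure count reaches a single position only through letters of one side. A
  mixture of the positions \<open>q + 1\<close> and \<open>q\<close> recurses through both sides
  into counts at \<open>q\<close> alone, and its coefficient vector \<open>mixvec\<close> is
  positive for \<open>0 < t < 1\<close>.\<close>

definition hyperbolic :: "(('i \<Rightarrow> real) \<Rightarrow> ('i \<Rightarrow> real) \<Rightarrow> real) \<Rightarrow> bool" where
  "hyperbolic B \<longleftrightarrow> (\<forall>u w. B w w \<ge> 0 \<longrightarrow> B u u * B w w \<le> (B u w)\<^sup>2)"

definition bform :: "'i set \<Rightarrow> ('i \<Rightarrow> 'i \<Rightarrow> real) \<Rightarrow> ('i \<Rightarrow> real) \<Rightarrow> ('i \<Rightarrow> real) \<Rightarrow> real" where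
  "bform I M u v = (\<Sum>i\<in>I. \<Sum>j\<in>I. M i j * u i * v j)"

lemma bform_lincomb_left:
  "bform I M (\<lambda>i. a * u i + b * w i) v = a * bform I M u v + b * bform I M w v"
  unfolding bform_def sum_distrib_left sum.distrib[symmetric]
  by (intro sum.cong refl) (simp add: algebra_simps)

lemma bform_lincomb_right:
  "bform I M v (\<lambda>i. a * u i + b * w i) = a * bform I M v u + b * bform I M v w"
  unfolding bform_def sum_distrib_left sum.distrib[symmetric]
  by (intro sum.cong refl) (simp add: algebra_simps)

lemma bform_commute:
  assumes "\<And>i j. i \<in> I \<Longrightarrow> j \<in> I \<Longrightarrow> M i j = M j i"
  shows "bform I M u v = bform I M v u"
  unfolding bform_def by (subst sum.swap) (intro sum.cong refl, simp add: assms)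

lemma bform_lincomb_square:
  assumes "\<And>i j. i \<in> I \<Longrightarrow> j \<in> I \<Longrightarrow> M i j = M j i"
  shows "bform I M (\<lambda>i. a * u i + b * w i) (\<lambda>i. a * u i + b * w i)
         = a\<^sup>2 * bform I M u u + 2 * a * b * bform I M u w + b\<^sup>2 * bform I M w w"
proof -
  have "bform I M w u = bform I M u w" by (rule bform_commute[OF assms])
  then show ?thesis
    unfolding bform_lincomb_left bform_lincomb_right
    by (simp add: power2_eq_square algebra_simps)
qed

lemma bform_row: "bform I M u v = (\<Sum>i\<in>I. u i * (\<Sum>j\<in>I. M i j * v j))"
  unfolding bform_def sum_distrib_left by (intro sum.cong refl) (simp add: algebra_simps)

text \<open>If the inequality failed for \<open>u\<close> and \<open>w\<close>, the form would be
  positive definite on their span; but that plane contains a nonzero vector orthogonal to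
  \<open>h\<close>, where the form is at most 0.\<close>

lemma hyperbolic_bformI:
  assumes sym: "\<And>i j. i \<in> I \<Longrightarrow> j \<in> I \<Longrightarrow> M i j = M j i"
    and neg: "\<And>v. bform I M v h = 0 \<Longrightarrow> bform I M v v \<le> 0"
  shows "hyperbolic (bform I M)"
  unfolding hyperbolic_def
proof (intro allI impI)
  fix u w assume w0: "bform I M w w \<ge> 0"
  let ?B = "bform I M"
  show "?B u u * ?B w w \<le> (?B u w)\<^sup>2"
  proof (rule ccontr)
    assume "\<not> ?thesis"
    then have gt: "(?B u w)\<^sup>2 < ?B u u * ?B w w" by simp
    have wpos: "?B w w > 0"
      using gt w0 by (smt (verit) mult_eq_0_iff zero_le_power2)
    define a where "a = ?B w h"
    define b where "b = - ?B u h"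
    have "?B (\<lambda>i. a * u i + b * w i) h = 0"
      unfolding bform_lincomb_left a_def b_def by simp
    from neg[OF this]
    have le: "a\<^sup>2 * ?B u u + 2 * a * b * ?B u w + b\<^sup>2 * ?B w w \<le> 0"
      by (simp add: bform_lincomb_square[OF sym])
    have anz: "a \<noteq> 0" using neg[of w] wpos unfolding a_def by auto
    have "?B w w * (a\<^sup>2 * ?B u u + 2 * a * b * ?B u w + b\<^sup>2 * ?B w w)
        = (b * ?B w w + a * ?B u w)\<^sup>2 + a\<^sup>2 * (?B u u * ?B w w - (?B u w)\<^sup>2)"
      by (simp add: power2_eq_square algebra_simps)
    moreover have "\<dots> > 0" using anz gt by (simp add: add_nonneg_pos)
    ultimately show False using le wpos by (smt (verit) mult_nonneg_nonpos)
  qed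
qed

section \<open>The local-global principle\<close>

lemma square_le_succ_square: "x \<le> (x + 1)\<^sup>2" if "x \<ge> 0" for x :: real
  using that by (simp add: power2_eq_square algebra_simps)

text \<open>Divided by \<open>D i\<close> in each row, the matrix fixes \<open>h\<close> and is
  self-adjoint for \<open>ip\<close>. A maximiser of the Rayleigh quotient orthogonal to
  \<open>h\<close>, with value \<open>lam > 0\<close>, satisfies \<open>lam <= lam^2\<close> by
  \<open>pull\<close> and \<open>loc\<close>, and \<open>lam <= 1\<close> by the Laplacian identity.
  Equality makes it a multiple of \<open>h\<close> along the edges, hence everywhere, against
  orthogonality.\<close>

lemma local_global_eigenvalue:
  fixes M :: "'i \<Rightarrow> 'i \<Rightarrow> real" and h :: "'i \<Rightarrow> real" and q :: "'i \<Rightarrow> ('i \<Rightarrow> real) \<Rightarrow> real"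
  assumes fin: "finite I"
    and sym: "\<And>i j. i \<in> I \<Longrightarrow> j \<in> I \<Longrightarrow> M i j = M j i"
    and nonneg: "\<And>i j. i \<in> I \<Longrightarrow> j \<in> I \<Longrightarrow> M i j \<ge> 0"
    and hpos: "\<And>i. i \<in> I \<Longrightarrow> h i > 0"
    and rowpos: "\<And>i. i \<in> I \<Longrightarrow> (\<Sum>j\<in>I. M i j * h j) > 0"
    and loc: "\<And>i v. i \<in> I \<Longrightarrow> q i v * (\<Sum>j\<in>I. M i j * h j) \<le> (\<Sum>j\<in>I. M i j * v j)\<^sup>2"
    and pull: "\<And>v. bform I M v v \<le> (\<Sum>i\<in>I. h i * q i v)"
    and conn: "\<And>i j. i \<in> I \<Longrightarrow> j \<in> I \<Longrightarrow>
                 i = j \<or> M i j > 0 \<or> (\<exists>l\<in>I. M i l > 0 \<and> M l j > 0)"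
    and orth: "bform I M v0 h = 0"
  shows "bform I M v0 v0 \<le> 0"
proof (rule ccontr)
  assume "\<not> ?thesis"
  then have v0: "bform I M v0 v0 > 0" by simp
  let ?B = "bform I M"
  define D where "D i = (\<Sum>j\<in>I. M i j * h j) / h i" for i
  have Dpos: "D i > 0" if "i \<in> I" for i
    using rowpos[OF that] hpos[OF that] by (simp add: D_def)
  have Dh: "(\<Sum>j\<in>I. M i j * h j) = D i * h i" if "i \<in> I" for i
    using hpos[OF that] by (simp add: D_def)
  define ip where "ip u v = (\<Sum>i\<in>I. D i * u i * v i)" for u v :: "'i \<Rightarrow> real"
  have Bh: "?B v h = ip v h" for v
    unfolding bform_row ip_def by (intro sum.cong refl) (simp add: Dh)
  have ip_nonneg: "ip v v \<ge> 0" for v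
    unfolding ip_def by (intro sum_nonneg) (simp add: Dpos less_imp_le mult.assoc)
  have ip_sq: "ip v v = (\<Sum>i\<in>I. D i * (v i)\<^sup>2)" for v
    unfolding ip_def by (simp add: power2_eq_square mult.assoc)
  have ip0: "v i = 0" if "ip v v = 0" "i \<in> I" for v i
  proof -
    have "\<forall>i\<in>I. D i * (v i)\<^sup>2 = 0"
      using that(1) unfolding ip_sq
      by (subst (asm) sum_nonneg_eq_0_iff[OF fin]) (auto simp: Dpos less_imp_le)
    then show ?thesis using Dpos[OF that(2)] that(2) by auto
  qed
  have ip_lin: "ip (\<lambda>i. a * u i + b * w i) v = a * ip u v + b * ip w v" for a b u w v
    unfolding ip_def sum_distrib_left sum.distrib[symmetric]
    by (intro sum.cong refl) (simp add: algebra_simps)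
  have ip_comm: "ip u v = ip v u" for u v
    unfolding ip_def by (intro sum.cong refl) simp
  \<comment> \<open>The graph Laplacian identity: the Rayleigh quotient of \<open>M\<close> with respect to \<open>ip\<close> is at most 1.\<close>
  have laplace: "2 * ip v v - 2 * ?B v v
      = (\<Sum>i\<in>I. \<Sum>j\<in>I. M i j * h i * h j * (v i / h i - v j / h j)\<^sup>2)" for v
  proof -
    have "(\<Sum>i\<in>I. \<Sum>j\<in>I. M i j * h i * h j * (v i / h i - v j / h j)\<^sup>2)
        = (\<Sum>i\<in>I. \<Sum>j\<in>I. M i j * h j * (v i)\<^sup>2 / h i + M i j * h i * (v j)\<^sup>2 / h j - 2 * (M i j * v i * v j))"
      using hpos by (intro sum.cong refl) (force simp: power2_eq_square field_simps)
    also have "\<dots> = (\<Sum>i\<in>I. \<Sum>j\<in>I. M i j * h j * (v i)\<^sup>2 / h i)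
        + (\<Sum>i\<in>I. \<Sum>j\<in>I. M i j * h i * (v j)\<^sup>2 / h j) - 2 * ?B v v"
      by (simp add: bform_def sum.distrib sum_subtractf sum_distrib_left)
    also have "(\<Sum>i\<in>I. \<Sum>j\<in>I. M i j * h i * (v j)\<^sup>2 / h j) = (\<Sum>i\<in>I. \<Sum>j\<in>I. M i j * h j * (v i)\<^sup>2 / h i)"
      by (subst sum.swap) (intro sum.cong refl, simp add: sym)
    also have "(\<Sum>i\<in>I. \<Sum>j\<in>I. M i j * h j * (v i)\<^sup>2 / h i) = ip v v"
      unfolding ip_sq D_def
      by (intro sum.cong refl) (simp add: sum_distrib_right sum_divide_distrib)
    finally show ?thesis by simp
  qed
  have le1: "?B v v \<le> ip v v" for v
  proof -
    have "(\<Sum>i\<in>I. \<Sum>j\<in>I. M i j * h i * h j * (v i / h i - v j / h j)\<^sup>2) \<ge> 0"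
      using hpos nonneg by (intro sum_nonneg) (simp add: less_imp_le)
    then show ?thesis using laplace[of v] by simp
  qed
  \<comment> \<open>Vectors are functions on a possibly infinite type, so the unit sphere becomes
    compact only by fixing them to 0 outside \<open>I\<close>. The interval bound
    \<open>1 / D i + 1\<close> replaces the square root of \<open>1 / D i\<close>.\<close>
  define K where "K = {v. (\<forall>i. i \<notin> I \<longrightarrow> v i = 0) \<and> ip v v = 1 \<and> ip v h = 0}"
  define P where "P = PiE UNIV (\<lambda>i. if i \<in> I then {- (1 / D i + 1) .. 1 / D i + 1} else {0::real})"
  have cP: "compact P"
  proof -
    have "compactin (product_topology (\<lambda>_. euclidean) UNIV) P"
      unfolding P_def by (subst compactin_PiE) (auto simp: compactin_euclidean_iff)
    then show ?thesis by (simp add: euclidean_product_topology compactin_euclidean_iff)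
  qed
  have cip: "continuous_on UNIV (\<lambda>v. ip v v)" "continuous_on UNIV (\<lambda>v. ip v h)"
    unfolding ip_def by (intro continuous_intros continuous_on_product_coordinates)+
  have cB: "continuous_on UNIV (\<lambda>v. ?B v v)"
    unfolding bform_def by (intro continuous_intros continuous_on_product_coordinates)
  have KP: "K = P \<inter> ({v. ip v v = 1} \<inter> {v. ip v h = 0})"
  proof (intro equalityI subsetI)
    fix v assume v: "v \<in> K"
    have "v i \<in> {- (1 / D i + 1) .. 1 / D i + 1}" if i: "i \<in> I" for i
    proof -
      have "D i * (v i)\<^sup>2 \<le> ip v v"
        unfolding ip_sq using fin i
        by (intro member_le_sum) (auto simp: Dpos less_imp_le)
      then have "(v i)\<^sup>2 \<le> 1 / D i" using v Dpos[OF i] by (simp add: K_def field_simps)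
      then have "\<bar>v i\<bar>\<^sup>2 \<le> (1 / D i + 1)\<^sup>2"
        using square_le_succ_square[of "1 / D i"] Dpos[OF i] by simp
      then have "\<bar>v i\<bar> \<le> 1 / D i + 1"
        using Dpos[OF i] by (intro power2_le_imp_le[of "\<bar>v i\<bar>"]) (auto simp: less_imp_le)
      then show ?thesis by auto
    qed
    then show "v \<in> P \<inter> ({v. ip v v = 1} \<inter> {v. ip v h = 0})"
      using v by (auto simp: K_def P_def)
  next
    fix v assume "v \<in> P \<inter> ({v. ip v v = 1} \<inter> {v. ip v h = 0})"
    then show "v \<in> K" unfolding K_def P_def PiE_UNIV_domain by (auto simp: Pi_iff split: if_splits)
  qed
  have cK: "compact K"
    unfolding KP
    by (intro compact_Int_closed cP closed_Int closed_Collect_eq cip continuous_on_const)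
  have normalise: "\<exists>w1\<in>K. ?B w1 w1 = ?B w w / ip w w" if wh: "ip w h = 0" and d0: "ip w w > 0" for w
  proof -
    define d where "d = ip w w"
    have d: "d > 0" using d0 by (simp add: d_def)
    define w1 where "w1 i = (if i \<in> I then (1 / sqrt d) * w i else 0)" for i
    have w1ip: "ip w1 u = (1 / sqrt d) * ip w u" for u
      unfolding ip_def w1_def sum_distrib_left by (intro sum.cong refl) simp
    have "ip w1 w1 = (1 / sqrt d) * ((1 / sqrt d) * d)"
      unfolding w1ip[of w1] ip_comm[of w w1] w1ip[of w] d_def by simp
    also have "\<dots> = 1" using d by simp
    finally have w1K: "w1 \<in> K" using wh w1ip[of h] by (simp add: K_def w1_def)
    have "?B w1 w1 = (\<Sum>i\<in>I. \<Sum>j\<in>I. (1 / d) * (M i j * w i * w j))"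
      unfolding bform_def w1_def using d by (intro sum.cong refl) (simp add: field_simps)
    then have "?B w1 w1 = ?B w w / d" by (simp add: bform_def sum_divide_distrib)
    with w1K show ?thesis by (auto simp: d_def)
  qed
  have c0: "ip v0 v0 > 0" using v0 le1[of v0] by simp
  obtain v1 where v1K: "v1 \<in> K" and v1B: "?B v1 v1 = ?B v0 v0 / ip v0 v0"
    using normalise[of v0] orth c0 by (auto simp: Bh)
  obtain v where vK: "v \<in> K" and vmax: "\<And>w. w \<in> K \<Longrightarrow> ?B w w \<le> ?B v v"
    using continuous_attains_sup[OF cK _ continuous_on_subset[OF cB]] v1K by blast
  define lam where "lam = ?B v v"
  have lampos: "lam > 0" using vmax[OF v1K] v1B v0 c0 unfolding lam_def by (smt (verit) divide_pos_pos)
  have vv: "ip v v = 1" and vh: "ip v h = 0" using vK by (auto simp: K_def)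
  have ray: "?B w w \<le> lam * ip w w" if wh: "ip w h = 0" for w
  proof (cases "ip w w = 0")
    case True
    then have "?B w w = 0" unfolding bform_def using ip0 by (auto intro!: sum.neutral)
    with True show ?thesis by simp
  next
    case False
    then have d: "ip w w > 0" using ip_nonneg[of w] by simp
    obtain w1 where "w1 \<in> K" "?B w1 w1 = ?B w w / ip w w" using normalise[OF wh d] by blast
    then show ?thesis using vmax[of w1] d by (simp add: lam_def pos_divide_le_eq mult.commute)
  qed
  \<comment> \<open>The first-order condition at the maximum, obtained from a quadratic in the step
    \<open>s\<close> that is never negative rather than from a derivative.\<close>
  have crit: "?B u v = lam * ip u v" if uh: "ip u h = 0" for u
  proof -
    define e where "e = lam * ip u v - ?B u v"
    define f where "f = lam * ip u u - ?B u u"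
    have fnn: "f \<ge> 0" using ray[OF uh] by (simp add: f_def)
    have g: "0 \<le> 2 * s * e + s\<^sup>2 * f" for s
    proof -
      have z: "ip (\<lambda>i. s * u i + 1 * v i) h = 0" using uh vh by (simp only: ip_lin)
      have "ip (\<lambda>i. s * u i + 1 * v i) (\<lambda>i. s * u i + 1 * v i)
          = s\<^sup>2 * ip u u + 2 * s * ip u v + ip v v"
        by (simp only: ip_lin ip_comm[of _ "\<lambda>i. s * u i + 1 * v i"] ip_comm[of v u])
          (simp add: power2_eq_square algebra_simps)
      moreover have "?B (\<lambda>i. s * u i + 1 * v i) (\<lambda>i. s * u i + 1 * v i)
          = s\<^sup>2 * ?B u u + 2 * s * ?B u v + ?B v v"
        by (simp only: bform_lincomb_square[OF sym]) simp
      ultimately show ?thesis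
        using ray[OF z] vv by (simp add: e_def f_def lam_def algebra_simps)
    qed
    have "e = 0"
    proof (rule ccontr)
      assume ne: "e \<noteq> 0"
      \<comment> \<open>The quadratic is minimal at \<open>- e / f\<close>; since \<open>f\<close>
        may be 0, \<open>f + 1\<close> takes its place.\<close>
      define s where "s = - e / (f + 1)"
      have es: "e = - (s * (f + 1))" using fnn by (simp add: s_def field_simps)
      have "2 * s * e + s\<^sup>2 * f = - (s\<^sup>2 * (f + 2))"
        unfolding es by (simp add: power2_eq_square algebra_simps)
      moreover have "s\<^sup>2 * (f + 2) > 0" using fnn ne es by (intro mult_pos_pos) auto
      ultimately show False using g[of s] by simp
    qed
    then show ?thesis by (simp add: e_def)
  qed
  define Nv where "Nv i = (\<Sum>j\<in>I. M i j * v j) / D i" for i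
  have Nvip: "ip u Nv = ?B u v" for u
    unfolding ip_def bform_row
    using Dpos by (intro sum.cong refl) (force simp: Nv_def)
  have "?B h v = ?B v h" by (rule bform_commute[OF sym])
  then have "ip Nv h = 0"
    using Nvip[of h] Bh[of v] vh ip_comm[of h Nv] by simp
  \<comment> \<open>\<open>Nv\<close> is itself orthogonal to \<open>h\<close>, so
    \<open>crit\<close> yields its norm without first showing that \<open>v\<close> is an
    eigenvector.\<close>
  from crit[OF this] have Nv2: "ip Nv Nv = lam\<^sup>2"
    using Nvip[of v] Nvip[of Nv] ip_comm[of v Nv] by (simp add: lam_def power2_eq_square)
  have "lam \<le> (\<Sum>i\<in>I. h i * q i v)" unfolding lam_def by (rule pull)
  also have "\<dots> \<le> (\<Sum>i\<in>I. D i * Nv i * Nv i)"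
  proof (rule sum_mono)
    fix i assume i: "i \<in> I"
    have "q i v * (D i * h i) \<le> (\<Sum>j\<in>I. M i j * v j)\<^sup>2" using loc[OF i] Dh[OF i] by simp
    then have "h i * q i v \<le> (\<Sum>j\<in>I. M i j * v j)\<^sup>2 / D i"
      using Dpos[OF i] by (simp add: field_simps)
    then show "h i * q i v \<le> D i * Nv i * Nv i"
      using Dpos[OF i] by (simp add: Nv_def power2_eq_square)
  qed
  also have "\<dots> = lam\<^sup>2" using Nv2 by (simp add: ip_def)
  finally have "lam \<ge> 1" using lampos by (simp add: power2_eq_square)
  then have "lam = 1" using le1[of v] vv by (simp add: lam_def)
  then have "(\<Sum>i\<in>I. \<Sum>j\<in>I. M i j * h i * h j * (v i / h i - v j / h j)\<^sup>2) = 0"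
    using laplace[of v] vv by (simp add: lam_def)
  then have "\<forall>i\<in>I. \<forall>j\<in>I. M i j * h i * h j * (v i / h i - v j / h j)\<^sup>2 = 0"
    using fin hpos nonneg
    by (subst (asm) sum_nonneg_eq_0_iff)
      (auto intro!: sum_nonneg simp: less_imp_le sum_nonneg_eq_0_iff)
  then have edge: "v i / h i = v j / h j" if "i \<in> I" "j \<in> I" "M i j > 0" for i j
    using that hpos[of i] hpos[of j] by fastforce
  have const: "v i / h i = v j / h j" if "i \<in> I" "j \<in> I" for i j
    using conn[OF that] edge that by metis
  have "I \<noteq> {}" using vv by (auto simp: ip_def)
  then obtain i0 where i0: "i0 \<in> I" by blast
  define t where "t = v i0 / h i0"
  have vt: "v i = t * h i" if "i \<in> I" for i
    using const[OF that i0] hpos[OF that] by (simp add: t_def field_simps)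
  have "ip v h = t * ip h h"
    unfolding ip_def sum_distrib_left by (intro sum.cong refl) (simp add: vt)
  moreover have "ip h h \<noteq> 0" using ip0[of h i0] hpos[OF i0] i0 by auto
  ultimately have "t = 0" using vh by simp
  then have "ip v v = 0" unfolding ip_def using vt by (auto intro!: sum.neutral)
  then show False using vv by simp
qed

lemma hyperbolic_local_global:
  fixes M :: "'i \<Rightarrow> 'i \<Rightarrow> real" and h :: "'i \<Rightarrow> real" and q :: "'i \<Rightarrow> ('i \<Rightarrow> real) \<Rightarrow> real"
  assumes fin: "finite I"
    and sym: "\<And>i j. i \<in> I \<Longrightarrow> j \<in> I \<Longrightarrow> M i j = M j i"
    and nonneg: "\<And>i j. i \<in> I \<Longrightarrow> j \<in> I \<Longrightarrow> M i j \<ge> 0"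
    and hpos: "\<And>i. i \<in> I \<Longrightarrow> h i > 0"
    and loc: "\<And>i v. i \<in> I \<Longrightarrow> q i v * (\<Sum>j\<in>I. M i j * h j) \<le> (\<Sum>j\<in>I. M i j * v j)\<^sup>2"
    and q0: "\<And>i v. i \<in> I \<Longrightarrow> (\<Sum>j\<in>I. M i j * h j) = 0 \<Longrightarrow> q i v \<le> 0"
    and pull: "\<And>v. bform I M v v \<le> (\<Sum>i\<in>I. h i * q i v)"
    and conn: "\<And>i j. i \<in> I \<Longrightarrow> j \<in> I \<Longrightarrow> (\<Sum>l\<in>I. M i l * h l) > 0 \<Longrightarrow>
                 (\<Sum>l\<in>I. M j l * h l) > 0 \<Longrightarrow>
                 i = j \<or> M i j > 0 \<or> (\<exists>l\<in>I. M i l > 0 \<and> M l j > 0)"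
  shows "hyperbolic (bform I M)"
proof -
  define S where "S = {i \<in> I. (\<Sum>j\<in>I. M i j * h j) > 0}"
  have SI: "S \<subseteq> I" by (auto simp: S_def)
  have row_nn: "(\<Sum>j\<in>I. M i j * h j) \<ge> 0" if "i \<in> I" for i
    using that nonneg hpos by (intro sum_nonneg) (simp add: less_imp_le)
  have zero: "M i j = 0" if "i \<in> I" "i \<notin> S" "j \<in> I" for i j
  proof -
    have "(\<Sum>j\<in>I. M i j * h j) = 0" using that row_nn[of i] by (auto simp: S_def)
    then have "M i j * h j = 0"
      using that nonneg hpos fin by (subst (asm) sum_nonneg_eq_0_iff) (auto simp: less_imp_le)
    then show ?thesis using hpos[OF that(3)] by simp
  qed
  have rowS: "(\<Sum>j\<in>S. M i j * v j) = (\<Sum>j\<in>I. M i j * v j)" if "i \<in> I" for i v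
    using SI that zero sym[OF that] by (intro sum.mono_neutral_left fin) auto
  have formS: "bform S M u v = bform I M u v" for u v
  proof -
    have "bform S M u v = (\<Sum>i\<in>S. u i * (\<Sum>j\<in>I. M i j * v j))"
      unfolding bform_row using SI by (intro sum.cong refl) (auto simp: rowS)
    also have "\<dots> = bform I M u v"
      unfolding bform_row using SI zero by (intro sum.mono_neutral_left fin) auto
    finally show ?thesis .
  qed
  have "bform S M v v \<le> 0" if "bform S M v h = 0" for v
  proof (rule local_global_eigenvalue[where h = h and q = q])
    show "finite S" using SI fin finite_subset by blast
    show "bform S M v v \<le> (\<Sum>i\<in>S. h i * q i v)" for v
    proof -
      have "bform S M v v \<le> (\<Sum>i\<in>I. h i * q i v)" using pull formS by simp
      also have "\<dots> = (\<Sum>i\<in>S. h i * q i v) + (\<Sum>i\<in>I - S. h i * q i v)"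
        using SI fin by (simp add: sum.subset_diff add.commute)
      also have "(\<Sum>i\<in>I - S. h i * q i v) \<le> 0"
      proof (intro sum_nonpos mult_nonneg_nonpos)
        fix i assume i: "i \<in> I - S"
        then show "0 \<le> h i" using hpos[of i] by simp
        show "q i v \<le> 0" using i row_nn[of i] by (intro q0) (auto simp: S_def)
      qed
      finally show ?thesis by simp
    qed
    show "i = j \<or> 0 < M i j \<or> (\<exists>l\<in>S. 0 < M i l \<and> 0 < M l j)" if "i \<in> S" "j \<in> S" for i j
      using conn[of i j] that zero by (fastforce simp: S_def)
    show "\<And>i. i \<in> S \<Longrightarrow> 0 < (\<Sum>j\<in>S. M i j * h j)" using rowS by (auto simp: S_def)
    show "\<And>i v. i \<in> S \<Longrightarrow> q i v * (\<Sum>j\<in>S. M i j * h j) \<le> (\<Sum>j\<in>S. M i j * v j)\<^sup>2"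
      using rowS loc SI by auto
  qed (use SI sym nonneg hpos that in \<open>auto simp: subset_iff\<close>)
  then have "hyperbolic (bform S M)"
    using SI sym by (intro hyperbolic_bformI[where h = h]) (auto simp: subset_iff)
  moreover have "bform S M = bform I M" by (intro ext) (rule formS)
  ultimately show ?thesis by simp
qed

section \<open>Limits of hyperbolic forms and forms of rank two\<close>

lemma hyperbolic_limit:
  assumes hyp: "\<And>t. 0 < t \<Longrightarrow> t < 1 \<Longrightarrow> hyperbolic (\<lambda>u v. t * B1 u v + (1 - t) * B0 u v)"
  shows "hyperbolic B1"
  unfolding hyperbolic_def
proof (intro allI impI)
  fix u w assume nn: "B1 w w \<ge> 0"
  \<comment> \<open>If \<open>B1 w w = 0\<close>, the right side is a square and the left side is 0.
    Otherwise \<open>B1 w w > 0\<close> persists for \<open>t\<close> near 1, so the premise of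
    hyperbolicity holds along the limit.\<close>
  show "B1 u u * B1 w w \<le> (B1 u w)\<^sup>2"
  proof (cases "B1 w w = 0")
    case False
    then have pos: "B1 w w > 0" using nn by simp
    let ?F = "at_left (1::real)"
    have lim: "((\<lambda>t. t * B1 x y + (1 - t) * B0 x y) \<longlongrightarrow> B1 x y) ?F" for x y
    proof -
      have "((\<lambda>t. t * B1 x y + (1 - t) * B0 x y) \<longlongrightarrow> 1 * B1 x y + (1 - 1) * B0 x y) ?F"
        by (intro tendsto_intros)
      then show ?thesis by simp
    qed
    have ev01: "\<forall>\<^sub>F t in ?F. 0 < t \<and> t < 1"
      using eventually_at_left_real[of 0 "1::real"] by (auto elim!: eventually_mono)
    have "\<forall>\<^sub>F t in ?F. (t * B1 u u + (1 - t) * B0 u u) * (t * B1 w w + (1 - t) * B0 w w)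
        \<le> (t * B1 u w + (1 - t) * B0 u w)\<^sup>2"
      using order_tendstoD(1)[OF lim pos] ev01
    proof eventually_elim
      case (elim t)
      then show ?case using hyp[of t] by (simp add: hyperbolic_def)
    qed
    then show ?thesis
      by (intro tendsto_le[OF _ tendsto_power[OF lim] tendsto_mult[OF lim lim]]) simp_all
  qed simp
qed

text \<open>The hypothesis is symmetric under exchanging \<open>t\<close> with \<open>1 - t\<close>,
  so both end points of the segment are reached.\<close>

lemma hyperbolic_limits:
  assumes hyp: "\<And>t. 0 < t \<Longrightarrow> t < 1 \<Longrightarrow> hyperbolic (\<lambda>u v. t * B1 u v + (1 - t) * B0 u v)"
  shows "hyperbolic B1" "hyperbolic B0"
proof -
  show "hyperbolic B1" using hyp by (rule hyperbolic_limit)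
  show "hyperbolic B0"
  proof (rule hyperbolic_limit)
    fix t :: real assume "0 < t" "t < 1"
    then show "hyperbolic (\<lambda>u v. t * B0 u v + (1 - t) * B1 u v)"
      using hyp[of "1 - t"] by (simp add: add.commute)
  qed
qed

text \<open>A 2-by-2 matrix of nonpositive determinant, evaluated on \<open>(f, g)\<close>: the
  defect in the inequality is minus this determinant times the square of the determinant of the two
  evaluated vectors.\<close>

lemma hyperbolic_binary:
  assumes "\<And>u v. B u v = \<alpha> * f u * f v + \<beta> * (f u * g v + g u * f v) + \<gamma> * g u * g v"
    and "\<alpha> * \<gamma> \<le> \<beta>\<^sup>2"
  shows "hyperbolic B"
  unfolding hyperbolic_def
proof (intro allI impI)
  fix u w
  have "(B u w)\<^sup>2 - B u u * B w w = (\<beta>\<^sup>2 - \<alpha> * \<gamma>) * (f u * g w - g u * f w)\<^sup>2"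
    unfolding assms(1) by (simp add: power2_eq_square algebra_simps)
  moreover have "\<dots> \<ge> 0" using assms(2) by simp
  ultimately show "B u u * B w w \<le> (B u w)\<^sup>2" by linarith
qed

section \<open>Recursions for weighted counts\<close>

lemma sum_pos_iff:
  fixes f :: "'b \<Rightarrow> real"
  assumes "finite A" "\<And>a. a \<in> A \<Longrightarrow> f a \<ge> 0"
  shows "sum f A > 0 \<longleftrightarrow> (\<exists>a\<in>A. f a > 0)"
proof -
  have "sum f A \<ge> 0" using assms(2) by (rule sum_nonneg)
  moreover have "sum f A = 0 \<longleftrightarrow> (\<forall>a\<in>A. f a = 0)"
    using assms by (rule sum_nonneg_eq_0_iff)
  ultimately show ?thesis using assms(2) by (metis order_less_le)
qed

lemma sum_rotate:
  assumes "\<And>i j l. (i, j, l) \<in> A \<Longrightarrow> (l, i, j) \<in> A' \<and> g' (l, i, j) = g (i, j, l)"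
    and "\<And>i j l. (i, j, l) \<in> A' \<Longrightarrow> (j, l, i) \<in> A"
  shows "sum g A = sum g' A'"
proof (rule sum.reindex_bij_witness[of _ "\<lambda>(i, j, l). (j, l, i)" "\<lambda>(i, j, l). (l, i, j)"])
  fix t assume "t \<in> A"
  obtain i j l where t: "t = (i, j, l)" by (cases t)
  show "(case case t of (i, j, l) \<Rightarrow> (l, i, j) of (i, j, l) \<Rightarrow> (j, l, i)) = t"
    "(case t of (i, j, l) \<Rightarrow> (l, i, j)) \<in> A'"
    "g' (case t of (i, j, l) \<Rightarrow> (l, i, j)) = g t"
    using assms(1)[of i j l] \<open>t \<in> A\<close> by (simp_all add: t)
next
  fix t assume "t \<in> A'"
  obtain i j l where t: "t = (i, j, l)" by (cases t)
  show "(case case t of (i, j, l) \<Rightarrow> (j, l, i) of (i, j, l) \<Rightarrow> (l, i, j)) = t"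
    "(case t of (i, j, l) \<Rightarrow> (j, l, i)) \<in> A"
    using assms(2)[of i j l] \<open>t \<in> A'\<close> by (simp_all add: t)
qed

text \<open>An injection into a finite set of the same size is onto, so relabelled extensions need
  only a range and an injectivity check.\<close>

lemma linear_extensions_iff:
  assumes "finite S"
  shows "L \<in> linear_extensions S r \<longleftrightarrow>
    L \<in> S \<rightarrow>\<^sub>E {1..card S} \<and> inj_on L S \<and> (\<forall>x\<in>S. \<forall>y\<in>S. (x, y) \<in> r \<and> x \<noteq> y \<longrightarrow> L x < L y)"
proof -
  have "bij_betw L S {1..card S}" if "L \<in> S \<rightarrow>\<^sub>E {1..card S}" "inj_on L S"
  proof -
    have "L ` S \<subseteq> {1..card S}" using that(1) by auto
    moreover have "card (L ` S) = card {1..card S}" using that(2) by (simp add: card_image)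
    ultimately have "L ` S = {1..card S}" by (intro card_subset_eq) auto
    then show ?thesis using that(2) by (simp add: bij_betw_def)
  qed
  then show ?thesis unfolding linear_extensions_def by (auto simp: bij_betw_def)
qed

lemma finite_linear_extensions_at:
  assumes "finite S"
  shows "finite (linear_extensions_at S r z k)"
proof (rule finite_subset)
  show "linear_extensions_at S r z k \<subseteq> S \<rightarrow>\<^sub>E {1..card S}"
    unfolding linear_extensions_at_def linear_extensions_def by auto
qed (use assms in \<open>intro finite_PiE, auto\<close>)

lemma sum_split_by_unique:
  fixes w :: "'b \<Rightarrow> real"
  assumes "finite A" "finite M" "\<And>L. L \<in> A \<Longrightarrow> \<exists>!x. x \<in> M \<and> P L x"
  shows "(\<Sum>L\<in>A. w L) = (\<Sum>x\<in>M. \<Sum>L\<in>{L\<in>A. P L x}. w L)"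
proof -
  have "w L = (\<Sum>x\<in>M. if P L x then w L else 0)" if L: "L \<in> A" for L
  proof -
    obtain x where x: "x \<in> M" "P L x" and un: "\<And>y. y \<in> M \<Longrightarrow> P L y \<Longrightarrow> y = x"
      using assms(3)[OF L] by (elim ex1E) blast
    have "(\<Sum>y\<in>M. if P L y then w L else 0) = (\<Sum>y\<in>M. if y = x then w L else 0)"
    proof (rule sum.cong[OF refl])
      fix y assume "y \<in> M"
      then have "P L y \<longleftrightarrow> y = x" using un x(2) by metis
      then show "(if P L y then w L else 0) = (if y = x then w L else 0)" by (rule if_cong) simp_all
    qed
    also have "\<dots> = w L" using x(1) assms(2) by (simp only: sum.delta if_True)
    finally show ?thesis by (rule sym)
  qed
  then have "(\<Sum>L\<in>A. w L) = (\<Sum>L\<in>A. \<Sum>x\<in>M. if P L x then w L else 0)" by (rule sum.cong[OF refl])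
  also have "\<dots> = (\<Sum>x\<in>M. \<Sum>L\<in>A. if P L x then w L else 0)" by (rule sum.swap)
  also have "\<dots> = (\<Sum>x\<in>M. \<Sum>L\<in>{L\<in>A. P L x}. w L)"
    by (rule sum.cong[OF refl]) (simp add: sum.inter_filter[OF assms(1)])
  finally show ?thesis .
qed

text \<open>The element at position 1 is minimal and, since \<open>z\<close> stands at
  \<open>Suc p \<ge> 2\<close>, differs from \<open>z\<close>. It lies below \<open>z\<close>, so
  its weight splits off as a factor, and all other positions drop by one.\<close>

lemma weighted_count_rec_min:
  assumes fin: "finite S" and z: "z \<in> S" and p: "p \<ge> 1"
  shows "weighted_count S r \<omega> z (Suc p) =
    (\<Sum>x\<in>{x\<in>S. x \<noteq> z \<and> (\<forall>y\<in>S. \<not> ((y, x) \<in> r \<and> y \<noteq> x))}. \<omega> x * weighted_count (S - {x}) r \<omega> z p)"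
    (is "_ = sum _ ?M")
proof -
  let ?A = "linear_extensions_at S r z (Suc p)"
  have uniq: "\<exists>!x. x \<in> ?M \<and> L x = 1" if L: "L \<in> ?A" for L
  proof -
    have b: "bij_betw L S {1..card S}" and o: "\<And>x y. x \<in> S \<Longrightarrow> y \<in> S \<Longrightarrow> (x, y) \<in> r \<Longrightarrow> x \<noteq> y \<Longrightarrow> L x < L y"
      and Lz: "L z = Suc p"
      using L by (auto simp: linear_extensions_at_def linear_extensions_def)
    have "card S \<ge> 1" using fin z by (metis One_nat_def Suc_leI card_gt_0_iff empty_iff)
    then have "1 \<in> L ` S" using b by (simp add: bij_betw_def)
    then obtain x where x: "x \<in> S" "L x = 1" by force
    have "\<not> ((y, x) \<in> r \<and> y \<noteq> x)" if "y \<in> S" for y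
    proof
      assume "(y, x) \<in> r \<and> y \<noteq> x"
      then have "L y < 1" using o[of y x] x that by simp
      moreover have "L y \<in> {1..card S}" using b that by (auto simp: bij_betw_def)
      ultimately show False by simp
    qed
    moreover have "x \<noteq> z" using Lz x p by auto
    ultimately have "x \<in> ?M \<and> L x = 1" using x by blast
    moreover have "y = x" if "y \<in> ?M" "L y = 1" for y
      using that x b by (auto simp: bij_betw_def inj_on_def)
    ultimately show ?thesis by (intro ex1I[of _ x]) blast+
  qed
  have "weighted_count S r \<omega> z (Suc p)
      = (\<Sum>x\<in>?M. \<Sum>L\<in>{L\<in>?A. L x = 1}. extension_weight S \<omega> z L)"
    unfolding weighted_count_def
    by (rule sum_split_by_unique[OF finite_linear_extensions_at[OF fin] _ uniq]) (simp add: fin)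
  also have "\<dots> = (\<Sum>x\<in>?M. \<omega> x * weighted_count (S - {x}) r \<omega> z p)"
  proof (intro sum.cong refl)
    fix x assume x: "x \<in> ?M"
    then have xS: "x \<in> S" and xz: "x \<noteq> z" by auto
    let ?S = "S - {x}"
    define m where "m = card ?S"
    have cS: "card S = Suc m" using fin xS by (metis card_Suc_Diff1 m_def)
    define i where "i L = (\<lambda>y\<in>?S. L y - 1)" for L :: "'a \<Rightarrow> nat"
    define j where "j L = (\<lambda>y\<in>S. if y = x then 1 else Suc (L y))" for L :: "'a \<Rightarrow> nat"
    have "(\<Sum>L\<in>{L\<in>?A. L x = 1}. extension_weight S \<omega> z L)
        = (\<Sum>L\<in>linear_extensions_at ?S r z p. \<omega> x * extension_weight ?S \<omega> z L)"
    proof (rule sum.reindex_bij_witness[of _ j i])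
      fix L assume "L \<in> {L \<in> ?A. L x = 1}"
      then have PiE: "L \<in> S \<rightarrow>\<^sub>E {1..card S}" and inj: "inj_on L S"
        and o: "\<And>x y. x \<in> S \<Longrightarrow> y \<in> S \<Longrightarrow> (x, y) \<in> r \<Longrightarrow> x \<noteq> y \<Longrightarrow> L x < L y"
        and Lz: "L z = Suc p" and Lx: "L x = 1"
        using fin by (auto simp: linear_extensions_at_def linear_extensions_iff)
      have ge2: "2 \<le> L y \<and> L y \<le> card S" if "y \<in> ?S" for y
      proof -
        have "L y \<noteq> L x" using inj that xS by (auto simp: inj_on_def)
        moreover have "L y \<in> {1..card S}" using PiE that by auto
        ultimately show ?thesis using Lx by auto
      qed
      show "j (i L) = L"
      proof
        fix y
        show "j (i L) y = L y"
          using ge2[of y] Lx PiE by (cases "y \<in> S") (auto simp: i_def j_def PiE_def extensional_def)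
      qed
      have "i L \<in> ?S \<rightarrow>\<^sub>E {1..card ?S}"
        using ge2 cS unfolding m_def[symmetric] by (force simp: i_def)
      moreover have "inj_on (i L) ?S"
      proof (rule inj_onI)
        fix y y' assume a: "y \<in> ?S" "y' \<in> ?S" "i L y = i L y'"
        then have "L y - 1 = L y' - 1" by (simp add: i_def)
        then have "L y = L y'" using ge2[OF a(1)] ge2[OF a(2)] by linarith
        then show "y = y'" using inj a by (auto simp: inj_on_def)
      qed
      moreover have "i L y < i L y'" if "y \<in> ?S" "y' \<in> ?S" "(y, y') \<in> r" "y \<noteq> y'" for y y'
      proof -
        have "L y < L y'" using o[of y y'] that by auto
        then have "L y - 1 < L y' - 1" using ge2[OF that(1)] by linarith
        then show ?thesis using that by (simp add: i_def)
      qed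
      moreover have "i L z = p" using z xz Lz by (simp add: i_def)
      ultimately show "i L \<in> linear_extensions_at ?S r z p"
        using fin by (auto simp: linear_extensions_at_def linear_extensions_iff)
      have "{y \<in> S. L y < L z} = insert x {y \<in> ?S. i L y < i L z}"
      proof (intro equalityI subsetI)
        fix y assume "y \<in> {y \<in> S. L y < L z}"
        then show "y \<in> insert x {y \<in> ?S. i L y < i L z}"
          using ge2[of y] Lz p z xz by (cases "y = x") (auto simp: i_def)
      next
        fix y assume "y \<in> insert x {y \<in> ?S. i L y < i L z}"
        then show "y \<in> {y \<in> S. L y < L z}"
          using ge2[of y] Lx Lz p z xS xz by (cases "y = x") (auto simp: i_def)
      qed
      then show "\<omega> x * extension_weight ?S \<omega> z (i L) = extension_weight S \<omega> z L"
        using fin by (simp add: extension_weight_def)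
    next
      fix L assume "L \<in> linear_extensions_at ?S r z p"
      then have PiE: "L \<in> ?S \<rightarrow>\<^sub>E {1..card ?S}" and inj: "inj_on L ?S"
        and o: "\<And>x y. x \<in> ?S \<Longrightarrow> y \<in> ?S \<Longrightarrow> (x, y) \<in> r \<Longrightarrow> x \<noteq> y \<Longrightarrow> L x < L y"
        and Lz: "L z = p"
        using fin by (auto simp: linear_extensions_at_def linear_extensions_iff)
      have rng: "1 \<le> L y \<and> L y \<le> m" if "y \<in> ?S" for y
        using PiE_mem[OF PiE that] unfolding m_def[symmetric] by auto
      show "i (j L) = L"
      proof
        fix y
        show "i (j L) y = L y"
          using PiE by (cases "y \<in> ?S") (auto simp: i_def j_def PiE_def extensional_def)
      qed
      have "j L \<in> S \<rightarrow>\<^sub>E {1..card S}"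
      proof (rule PiE_I)
        fix y assume "y \<in> S"
        then show "j L y \<in> {1..card S}"
          using rng[of y] cS by (cases "y = x") (simp_all add: j_def)
      qed (simp add: j_def)
      moreover have "inj_on (j L) S"
      proof (rule inj_onI)
        fix y y' assume a: "y \<in> S" "y' \<in> S" "j L y = j L y'"
        show "y = y'"
          using a rng[of y] rng[of y'] inj_onD[OF inj, of y y']
          by (cases "y = x"; cases "y' = x") (simp_all add: j_def)
      qed
      moreover have "j L y < j L y'" if "y \<in> S" "y' \<in> S" "(y, y') \<in> r" "y \<noteq> y'" for y y'
        using o[of y y'] rng[of y'] that x by (auto simp: j_def)
      moreover have "j L z = Suc p" "j L x = 1" using z xz Lz xS by (simp_all add: j_def)
      ultimately show "j L \<in> {L \<in> ?A. L x = 1}"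
        using fin by (auto simp: linear_extensions_at_def linear_extensions_iff)
    qed
    then show "(\<Sum>L\<in>{L\<in>?A. L x = 1}. extension_weight S \<omega> z L) = \<omega> x * weighted_count ?S r \<omega> z p"
      by (simp add: weighted_count_def sum_distrib_left)
  qed
  finally show ?thesis .
qed

text \<open>The element at the last position is maximal and stands above \<open>z\<close>, so it
  contributes no weight and its removal leaves all other positions alone.\<close>

lemma weighted_count_rec_max:
  assumes fin: "finite S" and z: "z \<in> S" and p: "p < card S"
  shows "weighted_count S r \<omega> z p =
    (\<Sum>x\<in>{x\<in>S. x \<noteq> z \<and> (\<forall>y\<in>S. \<not> ((x, y) \<in> r \<and> x \<noteq> y))}. weighted_count (S - {x}) r \<omega> z p)"
    (is "_ = sum _ ?M")
proof -
  let ?A = "linear_extensions_at S r z p"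
  have uniq: "\<exists>!x. x \<in> ?M \<and> L x = card S" if L: "L \<in> ?A" for L
  proof -
    have b: "bij_betw L S {1..card S}" and o: "\<And>x y. x \<in> S \<Longrightarrow> y \<in> S \<Longrightarrow> (x, y) \<in> r \<Longrightarrow> x \<noteq> y \<Longrightarrow> L x < L y"
      and Lz: "L z = p"
      using L by (auto simp: linear_extensions_at_def linear_extensions_def)
    have "card S \<in> L ` S" using b p by (simp add: bij_betw_def)
    then obtain x where x: "x \<in> S" "L x = card S" by force
    have "\<not> ((x, y) \<in> r \<and> x \<noteq> y)" if "y \<in> S" for y
    proof
      assume "(x, y) \<in> r \<and> x \<noteq> y"
      then have "card S < L y" using o[of x y] x that by simp
      moreover have "L y \<in> {1..card S}" using b that by (auto simp: bij_betw_def)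
      ultimately show False by simp
    qed
    moreover have "x \<noteq> z" using Lz x p by auto
    ultimately have "x \<in> ?M \<and> L x = card S" using x by blast
    moreover have "y = x" if "y \<in> ?M" "L y = card S" for y
      using that x b by (auto simp: bij_betw_def inj_on_def)
    ultimately show ?thesis by (intro ex1I[of _ x]) blast+
  qed
  have "weighted_count S r \<omega> z p
      = (\<Sum>x\<in>?M. \<Sum>L\<in>{L\<in>?A. L x = card S}. extension_weight S \<omega> z L)"
    unfolding weighted_count_def
    by (rule sum_split_by_unique[OF finite_linear_extensions_at[OF fin] _ uniq]) (simp add: fin)
  also have "\<dots> = (\<Sum>x\<in>?M. weighted_count (S - {x}) r \<omega> z p)"
  proof (intro sum.cong refl)
    fix x assume x: "x \<in> ?M"
    then have xS: "x \<in> S" and xz: "x \<noteq> z" by auto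
    let ?S = "S - {x}"
    define m where "m = card ?S"
    have cS: "card S = Suc m" using fin xS by (metis card_Suc_Diff1 m_def)
    define i where "i L = restrict L ?S" for L :: "'a \<Rightarrow> nat"
    define j where "j L = (\<lambda>y\<in>S. if y = x then card S else L y)" for L :: "'a \<Rightarrow> nat"
    have "(\<Sum>L\<in>{L\<in>?A. L x = card S}. extension_weight S \<omega> z L)
        = (\<Sum>L\<in>linear_extensions_at ?S r z p. extension_weight ?S \<omega> z L)"
    proof (rule sum.reindex_bij_witness[of _ j i])
      fix L assume "L \<in> {L \<in> ?A. L x = card S}"
      then have PiE: "L \<in> S \<rightarrow>\<^sub>E {1..card S}" and inj: "inj_on L S"
        and o: "\<And>x y. x \<in> S \<Longrightarrow> y \<in> S \<Longrightarrow> (x, y) \<in> r \<Longrightarrow> x \<noteq> y \<Longrightarrow> L x < L y"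
        and Lz: "L z = p" and Lx: "L x = card S"
        using fin by (auto simp: linear_extensions_at_def linear_extensions_iff)
      have rng: "1 \<le> L y \<and> L y \<le> m" if "y \<in> ?S" for y
      proof -
        have "L y \<noteq> L x" using inj that xS by (auto simp: inj_on_def)
        moreover have "L y \<in> {1..card S}" using PiE that by auto
        ultimately show ?thesis using Lx cS by auto
      qed
      show "j (i L) = L"
      proof
        fix y
        show "j (i L) y = L y"
          using Lx PiE by (cases "y \<in> S") (auto simp: i_def j_def PiE_def extensional_def)
      qed
      have "i L \<in> ?S \<rightarrow>\<^sub>E {1..card ?S}"
        using rng unfolding m_def[symmetric] by (force simp: i_def)
      moreover have "inj_on (i L) ?S"
        using inj by (auto simp: i_def inj_on_def)
      moreover have "i L y < i L y'" if "y \<in> ?S" "y' \<in> ?S" "(y, y') \<in> r" "y \<noteq> y'" for y y'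
        using o[of y y'] that by (auto simp: i_def)
      moreover have "i L z = p" using z xz Lz by (simp add: i_def)
      ultimately show "i L \<in> linear_extensions_at ?S r z p"
        using fin by (auto simp: linear_extensions_at_def linear_extensions_iff)
      have "{y \<in> S. L y < L z} = {y \<in> ?S. i L y < i L z}"
        using Lx Lz p xS z xz by (auto simp: i_def)
      then show "extension_weight ?S \<omega> z (i L) = extension_weight S \<omega> z L"
        by (simp add: extension_weight_def)
    next
      fix L assume "L \<in> linear_extensions_at ?S r z p"
      then have PiE: "L \<in> ?S \<rightarrow>\<^sub>E {1..card ?S}" and inj: "inj_on L ?S"
        and o: "\<And>x y. x \<in> ?S \<Longrightarrow> y \<in> ?S \<Longrightarrow> (x, y) \<in> r \<Longrightarrow> x \<noteq> y \<Longrightarrow> L x < L y"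
        and Lz: "L z = p"
        using fin by (auto simp: linear_extensions_at_def linear_extensions_iff)
      have rng: "1 \<le> L y \<and> L y \<le> m" if "y \<in> ?S" for y
        using PiE_mem[OF PiE that] unfolding m_def[symmetric] by auto
      show "i (j L) = L"
      proof
        fix y
        show "i (j L) y = L y"
          using PiE by (cases "y \<in> ?S") (auto simp: i_def j_def PiE_def extensional_def)
      qed
      have "j L \<in> S \<rightarrow>\<^sub>E {1..card S}"
      proof (rule PiE_I)
        fix y assume "y \<in> S"
        then show "j L y \<in> {1..card S}"
          using rng[of y] cS by (cases "y = x") (simp_all add: j_def)
      qed (simp add: j_def)
      moreover have "inj_on (j L) S"
      proof (rule inj_onI)
        fix y y' assume a: "y \<in> S" "y' \<in> S" "j L y = j L y'"
        show "y = y'"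
          using a rng[of y] rng[of y'] cS inj_onD[OF inj, of y y']
          by (cases "y = x"; cases "y' = x") (simp_all add: j_def)
      qed
      moreover have "j L y < j L y'" if "y \<in> S" "y' \<in> S" "(y, y') \<in> r" "y \<noteq> y'" for y y'
        using o[of y y'] rng[of y] cS that x by (cases "y' = x"; cases "y = x") (auto simp: j_def)
      moreover have "j L z = p" "j L x = card S" using z xz Lz xS by (simp_all add: j_def)
      ultimately show "j L \<in> {L \<in> ?A. L x = card S}"
        using fin by (auto simp: linear_extensions_at_def linear_extensions_iff)
    qed
    then show "(\<Sum>L\<in>{L\<in>?A. L x = card S}. extension_weight S \<omega> z L) = weighted_count ?S r \<omega> z p"
      by (simp add: weighted_count_def)
  qed
  finally show ?thesis .
qed

lemma weighted_count_eq_0: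
  assumes "finite S" "z \<in> S" "p = 0 \<or> p > card S"
  shows "weighted_count S r \<omega> z p = 0"
proof -
  have "L z \<in> {1..card S}" if "L \<in> linear_extensions S r" for L
    using that assms(2) by (auto simp: linear_extensions_def)
  then have "linear_extensions_at S r z p = {}"
    using assms(3) by (fastforce simp: linear_extensions_at_def)
  then show ?thesis by (simp add: weighted_count_def)
qed

lemma weighted_count_singleton: "weighted_count {z} r \<omega> z 1 = 1"
proof -
  have "linear_extensions_at {z} r z 1 = {\<lambda>x\<in>{z}. 1}"
    by (auto simp: linear_extensions_at_def linear_extensions_iff PiE_def extensional_def fun_eq_iff)
  then show ?thesis by (simp add: weighted_count_def extension_weight_def)
qed

lemma weighted_count_nonneg:
  assumes "\<And>x. x \<in> S \<Longrightarrow> \<omega> x \<ge> 0"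
  shows "weighted_count S r \<omega> z p \<ge> 0"
  unfolding weighted_count_def extension_weight_def
  using assms by (intro sum_nonneg prod_nonneg) auto

section \<open>The combinatorial atlas\<close>

text \<open>
  Side \<open>True\<close> stands for an element removed as the first one, below \<open>z\<close>, and \<open>False\<close> for an
  element removed as the last one, above \<open>z\<close>; letter \<open>j\<close> cannot be read before the letters that
  block it.
\<close>

datatype 'a letter = Letter (side: bool) (elt: 'a)

locale marked_poset =
  fixes X :: "'a set" and r :: "'a rel" and \<omega> :: "'a \<Rightarrow> real" and z :: 'a
  assumes finX: "finite X" and po: "partial_order_on X r"
    and pos: "\<And>x. x \<in> X \<Longrightarrow> \<omega> x > 0"
begin

definition lt :: "'a \<Rightarrow> 'a \<Rightarrow> bool" where
  "lt x y \<longleftrightarrow> (x, y) \<in> r \<and> x \<noteq> y"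

definition blocks :: "'a letter \<Rightarrow> 'a letter \<Rightarrow> bool" where
  "blocks i j \<longleftrightarrow> side i = side j \<and> (if side i then lt (elt i) (elt j) else lt (elt j) (elt i))"

definition wt :: "'a letter \<Rightarrow> real" where
  "wt i = (if side i then \<omega> (elt i) else 1)"

text \<open>An element that is both minimal and maximal has two available letters, one per side. The
  element \<open>z\<close> is never read, but while it lies in \<open>S\<close> it blocks the
  elements above it on side \<open>True\<close> and those below it on side
  \<open>False\<close>.\<close>

definition avail :: "'a set \<Rightarrow> 'a letter set" where
  "avail S = {i. elt i \<in> S \<and> elt i \<noteq> z \<and> (\<forall>y\<in>S. \<not> blocks (Letter (side i) y) i)}"

abbreviation N :: "'a set \<Rightarrow> nat \<Rightarrow> real" where
  "N S p \<equiv> weighted_count S r \<omega> z p"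

definition transport :: "'a letter \<Rightarrow> ('a letter \<Rightarrow> real) \<Rightarrow> 'a letter \<Rightarrow> real" where
  "transport i v j = (if blocks i j then v i else v j)"

text \<open>
  The diagonal entry collects the words \<open>i l\<close> in which \<open>l\<close> becomes available only after \<open>i\<close>; with
  this choice the row sums of \<open>C\<close> count all words that start with \<open>i\<close>. The vector
  \<open>transport i v\<close> extends \<open>v\<close> to the letters that become available in this way.
\<close>

definition C :: "('a set \<Rightarrow> real) \<Rightarrow> 'a set \<Rightarrow> 'a letter \<Rightarrow> 'a letter \<Rightarrow> real" where
  "C G S i j =
     (if i = j then \<Sum>l\<in>{l\<in>avail (S - {elt i}). blocks i l}. wt i * wt l * G (S - {elt i} - {elt l})
      else if elt i = elt j then 0
      else wt i * wt j * G (S - {elt i} - {elt j}))"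

abbreviation B :: "('a set \<Rightarrow> real) \<Rightarrow> 'a set \<Rightarrow> ('a letter \<Rightarrow> real) \<Rightarrow> ('a letter \<Rightarrow> real) \<Rightarrow> real" where
  "B G S \<equiv> bform (avail S) (C G S)"

definition marked :: "'a set \<Rightarrow> bool" where
  "marked S \<longleftrightarrow> S \<subseteq> X \<and> z \<in> S"

section \<open>Blocking and availability of letters\<close>

lemma lt_irrefl: "\<not> lt x x" by (simp add: lt_def)

lemma lt_trans:
  assumes "lt x y" "lt y w"
  shows "lt x w"
proof -
  have tr: "trans r" "antisym r" using po by (auto simp: partial_order_on_def preorder_on_def)
  have "(x, w) \<in> r" using transD[OF tr(1), of x y w] assms by (simp add: lt_def)
  moreover have "x \<noteq> w" using antisymD[OF tr(2), of x y] assms by (auto simp: lt_def)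
  ultimately show ?thesis by (simp add: lt_def)
qed

lemma lt_asym: "lt x y \<Longrightarrow> \<not> lt y x"
  using lt_trans lt_irrefl by blast

lemma blocks_trans: "blocks i j \<Longrightarrow> blocks j l \<Longrightarrow> blocks i l"
  using lt_trans[of "elt i" "elt j" "elt l"] lt_trans[of "elt l" "elt j" "elt i"]
  by (simp add: blocks_def split: if_splits)

lemma blocks_side: "blocks i j \<Longrightarrow> side i = side j"
  by (simp add: blocks_def)

lemma blocks_irrefl: "\<not> blocks i i" by (simp add: blocks_def lt_irrefl)

lemma marked_finite: "marked S \<Longrightarrow> finite S"
  using finX finite_subset by (auto simp: marked_def)

lemma marked_Diff: "marked S \<Longrightarrow> i \<in> avail S \<Longrightarrow> marked (S - {elt i})"
  by (auto simp: marked_def avail_def)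

lemma finite_avail: "finite S \<Longrightarrow> finite (avail S)"
  by (rule finite_subset[of _ "(\<lambda>(s, x). Letter s x) ` (UNIV \<times> S)"])
    (force simp: avail_def intro: letter.collapse[symmetric], simp)

lemma avail_elt: "i \<in> avail S \<Longrightarrow> elt i \<in> S" "i \<in> avail S \<Longrightarrow> elt i \<noteq> z"
  by (simp_all add: avail_def)

lemma wt_pos: "marked S \<Longrightarrow> i \<in> avail S \<Longrightarrow> wt i > 0"
  using pos by (auto simp: wt_def marked_def avail_def)

lemma avail_not_blocks: "i \<in> avail S \<Longrightarrow> elt j \<in> S \<Longrightarrow> \<not> blocks j i"
  using blocks_side[of j i] by (cases j) (auto simp: avail_def)

lemma avail_swap:
  assumes "i \<in> avail S" "j \<in> avail (S - {elt i})" "\<not> blocks i j"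
  shows "j \<in> avail S" "i \<in> avail (S - {elt j})"
proof -
  have ij: "elt j \<in> S" "elt j \<noteq> elt i" using avail_elt[OF assms(2)] by auto
  have "\<not> blocks (Letter (side j) y) j" if y: "y \<in> S" for y
  proof (cases "y = elt i")
    case False
    then show ?thesis using assms(2) y by (auto simp: avail_def)
  next
    case True
    show ?thesis
    proof (cases "side i = side j")
      case True
      then show ?thesis using assms(3) \<open>y = elt i\<close> by (cases i) auto
    next
      \<comment> \<open>On opposite sides, \<open>elt i\<close> blocks \<open>j\<close> from the
        side of \<open>j\<close> exactly if \<open>elt j\<close> blocks \<open>i\<close> from the
        side of \<open>i\<close>, which the availability of \<open>i\<close> excludes.\<close>
      case False
      have "\<not> blocks (Letter (side i) (elt j)) i" using avail_not_blocks[OF assms(1), of "(Letter (side i) (elt j))"] ij by simp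
      then show ?thesis using False \<open>y = elt i\<close> by (auto simp: blocks_def split: if_splits)
    qed
  qed
  then show "j \<in> avail S" using avail_elt[OF assms(2)] by (auto simp: avail_def)
  show "i \<in> avail (S - {elt j})" using assms(1) ij by (auto simp: avail_def)
qed

lemma avail_Diff:
  assumes "i \<in> avail S" "j \<in> avail S" "elt i \<noteq> elt j"
  shows "j \<in> avail (S - {elt i})" "\<not> blocks i j"
proof -
  show "j \<in> avail (S - {elt i})" using assms by (auto simp: avail_def)
  show "\<not> blocks i j" using avail_not_blocks[OF assms(2)] avail_elt(1)[OF assms(1)] by blast
qed

lemma avail_Diff_iff:
  assumes "i \<in> avail S"
  shows "{j \<in> avail (S - {elt i}). \<not> blocks i j} = {j \<in> avail S. elt i \<noteq> elt j}"
proof (intro equalityI subsetI)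
  fix j assume j: "j \<in> {j \<in> avail (S - {elt i}). \<not> blocks i j}"
  then have "elt j \<in> S - {elt i}" using avail_elt(1)[of j "S - {elt i}"] by simp
  then show "j \<in> {j \<in> avail S. elt i \<noteq> elt j}" using j avail_swap(1)[OF assms, of j] by auto
next
  fix j assume "j \<in> {j \<in> avail S. elt i \<noteq> elt j}"
  then show "j \<in> {j \<in> avail (S - {elt i}). \<not> blocks i j}" using avail_Diff[OF assms, of j] by blast
qed

section \<open>The matrix as a count of words\<close>

lemma C_sym: "C G S i j = C G S j i"
proof -
  have "S - {elt i} - {elt j} = S - {elt j} - {elt i}" by auto
  then show ?thesis by (auto simp: C_def)
qed

lemma C_nonneg:
  assumes "marked S" "i \<in> avail S" "j \<in> avail S" "\<And>S'. marked S' \<Longrightarrow> G S' \<ge> 0"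
  shows "C G S i j \<ge> 0"
proof -
  have m: "marked (S - {elt i})" by (rule marked_Diff[OF assms(1,2)])
  have "wt i * wt l * G (S - {elt i} - {elt l}) \<ge> 0" if l: "l \<in> avail (S - {elt i})" for l
    using wt_pos[OF assms(1,2)] wt_pos[OF m l] assms(4)[OF marked_Diff[OF m l]] by simp
  then show ?thesis
    using avail_Diff[OF assms(2,3)] by (auto simp: C_def intro!: sum_nonneg)
qed

lemma C_row:
  assumes S: "finite S" and i: "i \<in> avail S"
  shows "(\<Sum>j\<in>avail S. C G S i j * v j)
       = (\<Sum>j\<in>avail (S - {elt i}). wt i * wt j * G (S - {elt i} - {elt j}) * transport i v j)"
    (is "_ = sum ?f ?A")
proof -
  have "sum ?f ?A = sum ?f {j \<in> ?A. blocks i j} + sum ?f {j \<in> ?A. \<not> blocks i j}"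
  proof -
    have fA: "finite ?A" using S by (simp add: finite_avail)
    have "?A = {j \<in> ?A. blocks i j} \<union> {j \<in> ?A. \<not> blocks i j}" by blast
    then have "sum ?f ?A = sum ?f ({j \<in> ?A. blocks i j} \<union> {j \<in> ?A. \<not> blocks i j})"
      by (rule arg_cong[where f = "sum ?f"])
    also have "\<dots> = sum ?f {j \<in> ?A. blocks i j} + sum ?f {j \<in> ?A. \<not> blocks i j}"
      using fA by (intro sum.union_disjoint) auto
    finally show ?thesis .
  qed
  also have "sum ?f {j \<in> ?A. blocks i j} = C G S i i * v i"
    by (simp add: C_def transport_def sum_distrib_right)
  also have "sum ?f {j \<in> ?A. \<not> blocks i j} = (\<Sum>j\<in>{j \<in> avail S. elt i \<noteq> elt j}. C G S i j * v j)"
    unfolding avail_Diff_iff[OF i]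
  proof (rule sum.cong[OF refl])
    fix j assume "j \<in> {j \<in> avail S. elt i \<noteq> elt j}"
    then have "elt i \<noteq> elt j" "\<not> blocks i j" using avail_Diff_iff[OF i] by auto
    then show "?f j = C G S i j * v j" by (auto simp: C_def transport_def)
  qed
  also have "\<dots> = (\<Sum>j\<in>avail S - {i}. C G S i j * v j)"
    by (rule sum.mono_neutral_left) (auto simp: C_def finite_avail S)
  also have "C G S i i * v i + \<dots> = (\<Sum>j\<in>avail S. C G S i j * v j)"
    using i by (intro sum.remove[symmetric] finite_avail S)
  finally show ?thesis by (rule sym)
qed

lemma B_words:
  assumes S: "finite S"
  shows "B G S u v = (\<Sum>i\<in>avail S. \<Sum>j\<in>avail (S - {elt i}).
           wt i * wt j * G (S - {elt i} - {elt j}) * u i * transport i v j)"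
  unfolding bform_row
proof (rule sum.cong[OF refl])
  fix i assume i: "i \<in> avail S"
  show "u i * (\<Sum>j\<in>avail S. C G S i j * v j) = (\<Sum>j\<in>avail (S - {elt i}).
      wt i * wt j * G (S - {elt i} - {elt j}) * u i * transport i v j)"
    unfolding C_row[OF S i] sum_distrib_left by (intro sum.cong refl) (simp add: mult_ac)
qed

text \<open>The inheritance condition of the atlas: expanding \<open>G\<close> by one more letter
  turns the words starting with \<open>i\<close> into two-letter words of the smaller set. Blocking
  letters share a side and \<open>h\<close> depends only on the side, so \<open>transport\<close>
  fixes \<open>h\<close>.\<close>

lemma C_inherit:
  assumes S: "finite S" and i: "i \<in> avail S"
    and h: "\<And>i j. side i = side j \<Longrightarrow> h i = h j"
    and G: "\<And>j. j \<in> avail (S - {elt i}) \<Longrightarrow> G (S - {elt i} - {elt j})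
              = (\<Sum>l\<in>avail (S - {elt i} - {elt j}). h l * wt l * G' (S - {elt i} - {elt j} - {elt l}))"
  shows "(\<Sum>j\<in>avail S. C G S i j * v j) = wt i * B G' (S - {elt i}) (transport i v) h"
proof -
  have th: "transport j h l = h l" for j l
    unfolding transport_def using h[OF blocks_side] by metis
  have f: "finite (S - {elt i})" using S by simp
  show ?thesis
    unfolding C_row[OF S i] B_words[OF f] sum_distrib_left
    by (intro sum.cong refl) (simp add: G th sum_distrib_left sum_distrib_right mult_ac)
qed

section \<open>Three-letter words and the pullback inequality\<close>

definition words3 :: "'a set \<Rightarrow> ('a letter \<times> 'a letter \<times> 'a letter) set" where
  "words3 S = (SIGMA i:avail S. SIGMA j:avail (S - {elt i}). avail (S - {elt i} - {elt j}))"

lemma words3_swap12: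
  assumes "(i, j, l) \<in> words3 S" "\<not> blocks i j"
  shows "(j, i, l) \<in> words3 S"
proof -
  have "S - {elt i} - {elt j} = S - {elt j} - {elt i}" by auto
  then show ?thesis using assms avail_swap[of i S j] by (simp add: words3_def)
qed

lemma words3_swap23:
  assumes "(i, j, l) \<in> words3 S" "\<not> blocks j l"
  shows "(i, l, j) \<in> words3 S"
  using assms avail_swap[of j "S - {elt i}" l] by (simp add: words3_def)

lemma words3_not_blocks:
  assumes "(i, j, l) \<in> words3 S"
  shows "\<not> blocks j i" "\<not> blocks l i" "\<not> blocks l j"
proof -
  have a: "i \<in> avail S" "j \<in> avail (S - {elt i})" "l \<in> avail (S - {elt i} - {elt j})"
    using assms by (auto simp: words3_def)
  note b = avail_elt(1)[OF a(2)] avail_elt(1)[OF a(3)]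
  show "\<not> blocks j i" "\<not> blocks l i" "\<not> blocks l j"
    using avail_not_blocks[OF a(1)] avail_not_blocks[OF a(2)] b by auto
qed

lemma finite_words3: "finite S \<Longrightarrow> finite (words3 S)"
  unfolding words3_def by (intro finite_SigmaI finite_avail) auto

lemma sum_words3:
  assumes "finite S"
  shows "(\<Sum>(i, j, l)\<in>words3 S. f i j l)
    = (\<Sum>i\<in>avail S. \<Sum>j\<in>avail (S - {elt i}). \<Sum>l\<in>avail (S - {elt i} - {elt j}). f i j l)"
proof -
  have "(\<Sum>i\<in>avail S. \<Sum>j\<in>avail (S - {elt i}). \<Sum>l\<in>avail (S - {elt i} - {elt j}). f i j l)
    = (\<Sum>i\<in>avail S. \<Sum>(j, l)\<in>(SIGMA j:avail (S - {elt i}). avail (S - {elt i} - {elt j})). f i j l)"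
    using assms by (intro sum.cong refl sum.Sigma) (auto intro!: finite_avail)
  also have "\<dots> = (\<Sum>(i, j, l)\<in>words3 S. f i j l)"
    unfolding words3_def using assms
    by (subst sum.Sigma) (auto intro!: finite_avail)
  finally show ?thesis by (rule sym)
qed

text \<open>
  Words of three letters grouped by the blocking pattern. Classes 0, 1 and 2 are matched by
  rotating the word, class 3 by swapping its first two letters.
\<close>

definition word_class :: "'a letter \<times> 'a letter \<times> 'a letter \<Rightarrow> nat" where
  "word_class = (\<lambda>(i, j, l).
     if \<not> blocks i j \<and> \<not> blocks i l \<and> \<not> blocks j l then 0
     else if blocks i j \<and> \<not> blocks i l \<and> \<not> blocks j l then 1
     else if \<not> blocks i j \<and> \<not> blocks i l \<and> blocks j l then 2
     else if \<not> blocks i j \<and> blocks i l \<and> blocks j l then 3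
     else 4)"

abbreviation words3_in :: "'a set \<Rightarrow> nat \<Rightarrow> ('a letter \<times> 'a letter \<times> 'a letter) set" where
  "words3_in S c \<equiv> {t \<in> words3 S. word_class t = c}"

lemma word_class_eq:
  "word_class (i, j, l) = 0 \<longleftrightarrow> \<not> blocks i j \<and> \<not> blocks i l \<and> \<not> blocks j l"
  "word_class (i, j, l) = 1 \<longleftrightarrow> blocks i j \<and> \<not> blocks i l \<and> \<not> blocks j l"
  "word_class (i, j, l) = 2 \<longleftrightarrow> \<not> blocks i j \<and> \<not> blocks i l \<and> blocks j l"
  "word_class (i, j, l) = 3 \<longleftrightarrow> \<not> blocks i j \<and> blocks i l \<and> blocks j l"
  "word_class (i, j, l) = 4 \<longleftrightarrow> (blocks i j \<and> blocks i l) \<or> (\<not> blocks i j \<and> blocks i l \<and> \<not> blocks j l) \<or>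
     (blocks i j \<and> blocks j l)"
  using blocks_trans[of i j l] by (simp_all add: word_class_def)

lemma sum_word_class:
  assumes "finite S"
  shows "sum f (words3 S) = sum f (words3_in S 0) + sum f (words3_in S 1) + sum f (words3_in S 2)
    + sum f (words3_in S 3) + sum f (words3_in S 4)"
proof -
  have "sum f (words3 S) = (\<Sum>c\<in>{0,1,2,3,4}. sum f (words3_in S c))"
  proof (rule sum.group[symmetric])
    have "word_class (i, j, l) \<in> {0, 1, 2, 3, 4}" for i j l
      by (simp add: word_class_def)
    then show "word_class ` words3 S \<subseteq> {0, 1, 2, 3, 4}"
      by (intro image_subsetI) (metis prod_cases3)
  qed (simp_all add: finite_words3 assms)
  then show ?thesis by (simp add: add_ac)
qed

lemma words3_rotate:
  assumes "(i, j, l) \<in> words3 S" "\<not> blocks i j" "\<not> blocks i l"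
  shows "(j, l, i) \<in> words3 S"
  using words3_swap23[OF words3_swap12[OF assms(1,2)] assms(3)] .

lemma words3_rotate':
  assumes "(i, j, l) \<in> words3 S" "\<not> blocks i l" "\<not> blocks j l"
  shows "(l, i, j) \<in> words3 S"
  using words3_swap12[OF words3_swap23[OF assms(1,3)] assms(2)] .

lemma words3_in_rotate:
  "(i, j, l) \<in> words3_in S 0 \<Longrightarrow> (l, i, j) \<in> words3_in S 0"
  "(i, j, l) \<in> words3_in S 0 \<Longrightarrow> (j, l, i) \<in> words3_in S 0"
  "(i, j, l) \<in> words3_in S 1 \<Longrightarrow> (l, i, j) \<in> words3_in S 2"
  "(i, j, l) \<in> words3_in S 2 \<Longrightarrow> (j, l, i) \<in> words3_in S 1"
  using words3_rotate[of i j l S] words3_rotate'[of i j l S] words3_not_blocks[of i j l S]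
  by (simp_all only: mem_Collect_eq word_class_eq simp_thms)

text \<open>The pullback condition of the atlas. On the left the coefficient \<open>h\<close>
  belongs to the third letter of a word, on the right to the first; rotation moves it, and the
  weight \<open>W\<close> depends only on which letters occur, not on their order.\<close>

lemma C_pull:
  assumes S: "marked S"
    and h: "\<And>i j. side i = side j \<Longrightarrow> h i = h j" and hnn: "\<And>i. h i \<ge> 0"
    and G'nn: "\<And>S'. marked S' \<Longrightarrow> G' S' \<ge> 0"
    and G: "\<And>i j. i \<in> avail S \<Longrightarrow> j \<in> avail (S - {elt i}) \<Longrightarrow> G (S - {elt i} - {elt j})
              = (\<Sum>l\<in>avail (S - {elt i} - {elt j}). h l * wt l * G' (S - {elt i} - {elt j} - {elt l}))"
  shows "B G S v v \<le> (\<Sum>i\<in>avail S. h i * (wt i * B G' (S - {elt i}) (transport i v) (transport i v)))"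
proof -
  note fS = marked_finite[OF S]
  have fS': "finite (S - {x})" for x using fS by simp
  define W where "W i j l = wt i * wt j * wt l * G' (S - {elt i} - {elt j} - {elt l})" for i j l
  have W12: "W i j l = W j i l" and W23: "W i j l = W i l j" for i j l
  proof -
    have "S - {elt i} - {elt j} - {elt l} = S - {elt j} - {elt i} - {elt l}"
      "S - {elt i} - {elt j} - {elt l} = S - {elt i} - {elt l} - {elt j}" by auto
    then show "W i j l = W j i l" "W i j l = W i l j" by (simp_all add: W_def mult_ac)
  qed
  have Wrot: "W l i j = W i j l" "W j l i = W i j l" for i j l
    using W12[of l i j] W23[of i l j] W12[of j l i] W23[of l j i] W12[of l i j] by simp_all
  have hblocks: "h j = h i" if "blocks i j" for i j
    using h[OF blocks_side[OF that]] by simp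
  have Wnn: "W i j l \<ge> 0" if "(i, j, l) \<in> words3 S" for i j l
  proof -
    have a: "i \<in> avail S" "j \<in> avail (S - {elt i})" "l \<in> avail (S - {elt i} - {elt j})"
      using that by (auto simp: words3_def)
    note m1 = marked_Diff[OF S a(1)]
    note m2 = marked_Diff[OF m1 a(2)]
    note m3 = marked_Diff[OF m2 a(3)]
    show ?thesis
      using wt_pos[OF S a(1)] wt_pos[OF m1 a(2)] wt_pos[OF m2 a(3)] G'nn[OF m3] by (simp add: W_def)
  qed
  define P where "P = (\<lambda>(i, j, l). W i j l * (h i * transport i v j * transport j (transport i v) l))"
  define Q where "Q = (\<lambda>(i, j, l). W i j l * (h l * v i * transport i v j))"
  have lhs: "B G S v v = sum Q (words3 S)"
  proof -
    have "B G S v v = (\<Sum>i\<in>avail S. \<Sum>j\<in>avail (S - {elt i}). \<Sum>l\<in>avail (S - {elt i} - {elt j}).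
        W i j l * (h l * v i * transport i v j))"
      unfolding B_words[OF fS]
    proof (intro sum.cong refl)
      fix i j assume "i \<in> avail S" "j \<in> avail (S - {elt i})"
      then show "wt i * wt j * G (S - {elt i} - {elt j}) * v i * transport i v j =
         (\<Sum>l\<in>avail (S - {elt i} - {elt j}). W i j l * (h l * v i * transport i v j))"
        unfolding G[OF \<open>i \<in> avail S\<close> \<open>j \<in> avail (S - {elt i})\<close>] W_def sum_distrib_left sum_distrib_right
        by (intro sum.cong refl) (simp add: mult_ac)
    qed
    then show ?thesis unfolding Q_def sum_words3[OF fS] .
  qed
  have rhs: "(\<Sum>i\<in>avail S. h i * (wt i * B G' (S - {elt i}) (transport i v) (transport i v))) = sum P (words3 S)"
    unfolding P_def sum_words3[OF fS] B_words[OF fS'] sum_distrib_left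
    by (intro sum.cong refl) (simp add: W_def mult_ac)
  have c0: "sum Q (words3_in S 0) = sum P (words3_in S 0)"
  proof (rule sum_rotate)
    fix i j l assume a: "(i, j, l) \<in> words3_in S 0"
    then have "P (l, i, j) = Q (i, j, l)"
      using Wrot[of i j l] words3_not_blocks[of i j l S]
      by (simp add: P_def Q_def transport_def word_class_eq del: One_nat_def)
    then show "(l, i, j) \<in> words3_in S 0 \<and> P (l, i, j) = Q (i, j, l)"
      using words3_in_rotate(1)[OF a] by blast
  qed (rule words3_in_rotate(2))
  have c21: "sum Q (words3_in S 1) = sum P (words3_in S 2)"
  proof (rule sum_rotate)
    fix i j l assume a: "(i, j, l) \<in> words3_in S 1"
    then have "P (l, i, j) = Q (i, j, l)"
      using Wrot[of i j l] words3_not_blocks[of i j l S]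
      by (simp add: P_def Q_def transport_def word_class_eq del: One_nat_def)
    then show "(l, i, j) \<in> words3_in S 2 \<and> P (l, i, j) = Q (i, j, l)"
      using words3_in_rotate(3)[OF a] by blast
  qed (rule words3_in_rotate(4))
  \<comment> \<open>Rotating class 1 into class 2 took \<open>Q\<close> to \<open>P\<close> above;
    here it takes \<open>P\<close> to \<open>Q\<close>, where \<open>h i = h j\<close> holds because
    \<open>i\<close> blocks \<open>j\<close>.\<close>
  have c12: "sum P (words3_in S 1) = sum Q (words3_in S 2)"
  proof (rule sum_rotate)
    fix i j l assume a: "(i, j, l) \<in> words3_in S 1"
    then have "Q (l, i, j) = P (i, j, l)"
      using Wrot[of i j l] words3_not_blocks[of i j l S] hblocks[of i j]
      by (simp add: P_def Q_def transport_def word_class_eq del: One_nat_def)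
    then show "(l, i, j) \<in> words3_in S 2 \<and> Q (l, i, j) = P (i, j, l)"
      using words3_in_rotate(3)[OF a] by blast
  qed (rule words3_in_rotate(4))
  \<comment> \<open>The only class where equality may fail: \<open>2 v\<^sub>i v\<^sub>j \<le> v\<^sub>i\<^sup>2 + v\<^sub>j\<^sup>2\<close>, summed over a word and its swap.\<close>
  have c3: "sum Q (words3_in S 3) \<le> sum P (words3_in S 3)"
  proof -
    have sw: "(\<Sum>(i, j, l)\<in>words3_in S 3. W i j l * h l * (v i)\<^sup>2) = (\<Sum>(i, j, l)\<in>words3_in S 3. W i j l * h l * (v j)\<^sup>2)"
      by (rule sum.reindex_bij_witness[of _ "\<lambda>(i, j, l). (j, i, l)" "\<lambda>(i, j, l). (j, i, l)"])
        (auto simp: word_class_eq W12 intro: words3_swap12 dest: words3_not_blocks)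
    have "2 * sum Q (words3_in S 3) = (\<Sum>(i, j, l)\<in>words3_in S 3. 2 * (W i j l * h l * v i * v j))"
      unfolding sum_distrib_left
      by (intro sum.cong refl) (auto simp: Q_def word_class_eq transport_def)
    also have "\<dots> \<le> (\<Sum>(i, j, l)\<in>words3_in S 3. W i j l * h l * (v i)\<^sup>2 + W i j l * h l * (v j)\<^sup>2)"
    proof (rule sum_mono)
      fix t assume "t \<in> words3_in S 3"
      obtain i j l where t: "t = (i, j, l)" by (cases t)
      have "0 \<le> W i j l * h l * (v i - v j)\<^sup>2"
        using \<open>t \<in> _\<close> t Wnn hnn[of l] by simp
      then show "(case t of (i, j, l) \<Rightarrow> 2 * (W i j l * h l * v i * v j))
          \<le> (case t of (i, j, l) \<Rightarrow> W i j l * h l * (v i)\<^sup>2 + W i j l * h l * (v j)\<^sup>2)"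
        by (simp add: t power2_diff algebra_simps)
    qed
    also have "\<dots> = 2 * (\<Sum>(i, j, l)\<in>words3_in S 3. W i j l * h l * (v j)\<^sup>2)"
      using sw by (simp add: case_prod_unfold sum.distrib)
    also have "(\<Sum>(i, j, l)\<in>words3_in S 3. W i j l * h l * (v j)\<^sup>2) = sum P (words3_in S 3)"
    proof (rule sum.cong[OF refl])
      fix t assume a: "t \<in> words3_in S 3"
      obtain i j l where t: "t = (i, j, l)" by (cases t)
      have "h l = h i" using a by (intro hblocks) (simp add: t word_class_eq)
      then show "(case t of (i, j, l) \<Rightarrow> W i j l * h l * (v j)\<^sup>2) = P t"
        using a by (simp add: P_def t transport_def word_class_eq power2_eq_square)
    qed
    finally show ?thesis by simp
  qed
  \<comment> \<open>In all remaining patterns \<open>i\<close> blocks \<open>l\<close>, so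
    \<open>h l = h i\<close>, and the two summands agree on every word without
    rearrangement.\<close>
  have c4: "sum Q (words3_in S 4) = sum P (words3_in S 4)"
  proof (rule sum.cong[OF refl])
    fix t assume a: "t \<in> words3_in S 4"
    obtain i j l where t: "t = (i, j, l)" by (cases t)
    have cl: "(blocks i j \<and> blocks i l) \<or> (\<not> blocks i j \<and> blocks i l \<and> \<not> blocks j l) \<or> (blocks i j \<and> blocks j l)"
      using a by (simp only: t word_class_eq mem_Collect_eq)
    then have "blocks i l" using blocks_trans[of i j l] by blast
    then have "h l = h i" by (rule hblocks)
    then show "Q t = P t"
      using cl \<open>blocks i l\<close> by (auto simp: P_def Q_def t transport_def)
  qed
  show ?thesis
    unfolding lhs rhs sum_word_class[OF fS] using c0 c12 c21 c3 c4 by linarith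
qed

section \<open>Recursion for mixtures of two positions\<close>

lemma N_nonneg: "marked S \<Longrightarrow> N S p \<ge> 0"
  by (intro weighted_count_nonneg less_imp_le pos) (auto simp: marked_def)

lemma avail_side_eq:
  "{l \<in> avail S. side l = s} = Letter s ` {x \<in> S. x \<noteq> z \<and> (\<forall>y\<in>S. \<not> blocks (Letter s y) (Letter s x))}"
proof (intro equalityI subsetI)
  fix l assume "l \<in> {l \<in> avail S. side l = s}"
  then show "l \<in> Letter s ` {x \<in> S. x \<noteq> z \<and> (\<forall>y\<in>S. \<not> blocks (Letter s y) (Letter s x))}"
    by (cases l) (auto simp: avail_def)
qed (auto simp: avail_def)

text \<open>On side \<open>False\<close> the case \<open>p > card S\<close> holds because both sides
  are 0; at \<open>p = card S\<close> the right side is 0 although \<open>z\<close> may be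
  last.\<close>

lemma N_rec:
  assumes S: "marked S" and "s \<Longrightarrow> p \<ge> 2" and "\<not> s \<Longrightarrow> p \<noteq> card S"
  shows "N S p = (\<Sum>l\<in>{l \<in> avail S. side l = s}. wt l * N (S - {elt l}) (if s then p - 1 else p))"
proof -
  note fS = marked_finite[OF S]
  have zS: "z \<in> S" using S by (simp add: marked_def)
  have inj: "inj_on (Letter s) A" for A by (simp add: inj_on_def)
  show ?thesis
  proof (cases s)
    case True
    obtain p' where p: "p = Suc p'" "p' \<ge> 1" using assms(2)[OF True] by (cases p) auto
    show ?thesis
      unfolding avail_side_eq sum.reindex[OF inj] p weighted_count_rec_min[OF fS zS p(2)]
      by (simp add: True blocks_def lt_def wt_def)
  next
    case False
    consider "p < card S" | "p > card S" using assms(3)[OF False] by linarith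
    then show ?thesis
    proof cases
      case 1
      show ?thesis
        unfolding avail_side_eq sum.reindex[OF inj] weighted_count_rec_max[OF fS zS 1]
        by (simp add: False blocks_def lt_def wt_def)
    next
      case 2
      have "N (S - {elt l}) p = 0" if "l \<in> avail S" for l
      proof -
        have "card (S - {elt l}) < p" using 2 card_mono[of S "S - {elt l}"] fS by auto
        then show ?thesis
          using marked_Diff[OF S that] fS by (intro weighted_count_eq_0) (auto simp: marked_def)
      qed
      then have "(\<Sum>l\<in>{l \<in> avail S. side l = s}. wt l * N (S - {elt l}) (if s then p - 1 else p)) = 0"
        using False by (intro sum.neutral) auto
      then show ?thesis using 2 fS zS by (simp add: weighted_count_eq_0)
    qed
  qed
qed

definition N_mix :: "real \<Rightarrow> nat \<Rightarrow> 'a set \<Rightarrow> real" where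
  "N_mix t q S = t * N S (Suc q) + (1 - t) * N S q"

definition mixvec :: "real \<Rightarrow> 'a letter \<Rightarrow> real" where
  "mixvec t l = (if side l then t else 1 - t)"

lemma N_mix_rec:
  assumes S: "marked S" and q: "q \<ge> 1" "q \<noteq> card S"
  shows "N_mix t q S = (\<Sum>l\<in>avail S. mixvec t l * wt l * N (S - {elt l}) q)"
proof -
  note fS = marked_finite[OF S]
  have "(\<Sum>l\<in>avail S. mixvec t l * wt l * N (S - {elt l}) q)
    = (\<Sum>l\<in>{l\<in>avail S. side l = True} \<union> {l\<in>avail S. side l = False}. mixvec t l * wt l * N (S - {elt l}) q)"
    by (rule sum.cong) auto
  also have "\<dots> = (\<Sum>l\<in>{l\<in>avail S. side l = True}. mixvec t l * wt l * N (S - {elt l}) q)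
      + (\<Sum>l\<in>{l\<in>avail S. side l = False}. mixvec t l * wt l * N (S - {elt l}) q)"
    using finite_avail[OF fS] by (intro sum.union_disjoint) auto
  also have "(\<Sum>l\<in>{l\<in>avail S. side l = True}. mixvec t l * wt l * N (S - {elt l}) q) = t * N S (Suc q)"
    using q by (subst N_rec[OF S, of True]) (auto simp: mixvec_def sum_distrib_left mult_ac intro!: sum.cong)
  also have "(\<Sum>l\<in>{l\<in>avail S. side l = False}. mixvec t l * wt l * N (S - {elt l}) q) = (1 - t) * N S q"
    using q by (subst N_rec[OF S, of False]) (auto simp: mixvec_def sum_distrib_left mult_ac intro!: sum.cong)
  finally show ?thesis by (simp add: N_mix_def)
qed

section \<open>The possible positions of \<open>z\<close>\<close>

text \<open>
  The number of elements that lie on side \<open>s\<close> of \<open>z\<close> in every linear extension; it decides which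
  positions of \<open>z\<close> are possible.
\<close>

definition forced :: "bool \<Rightarrow> 'a set \<Rightarrow> nat" where
  "forced s S = card {x \<in> S. blocks (Letter s x) (Letter s z)}"

definition forced_by :: "bool \<Rightarrow> 'a letter \<Rightarrow> nat" where
  "forced_by s l = (if blocks l (Letter s z) then 1 else 0)"

lemma blocks_flip: "blocks (Letter s x) (Letter s y) \<longleftrightarrow> blocks (Letter (\<not> s) y) (Letter (\<not> s) x)"
  by (auto simp: blocks_def)

lemma blocks_asym: "blocks i j \<Longrightarrow> \<not> blocks j i"
  using blocks_trans blocks_irrefl by blast

lemma letter_eqI: "side i = side j \<Longrightarrow> elt i = elt j \<Longrightarrow> i = j"
  by (cases i; cases j) simp

lemma not_blocks_marked:
  assumes "marked S" "l \<in> avail S"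
  shows "\<not> blocks (Letter s z) l"
  using avail_not_blocks[OF assms(2), of "Letter s z"] assms(1) by (simp add: marked_def)

text \<open>A letter on the side opposite to \<open>s\<close> cannot carry an element forced to
  \<open>s\<close>: then \<open>z\<close> would block that letter.\<close>

lemma forced_Diff:
  assumes S: "marked S" and l: "l \<in> avail S"
  shows "forced s (S - {elt l}) + forced_by s l = forced s S"
proof -
  note fS = marked_finite[OF S]
  let ?A = "{x \<in> S. blocks (Letter s x) (Letter s z)}"
  have eq: "{x \<in> S - {elt l}. blocks (Letter s x) (Letter s z)} = ?A - {elt l}" by auto
  have mem: "elt l \<in> ?A \<longleftrightarrow> blocks l (Letter s z)"
  proof (cases "side l = s")
    case True
    then show ?thesis using avail_elt(1)[OF l] by (cases l) auto
  next
    case False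
    have "\<not> blocks (Letter (side l) z) l" using not_blocks_marked[OF S l] .
    then have "\<not> blocks (Letter s (elt l)) (Letter s z)"
      using False blocks_flip[of s "elt l" z] by (cases l) auto
    then show ?thesis using False blocks_side[of l "Letter s z"] by auto
  qed
  show ?thesis
  proof (cases "blocks l (Letter s z)")
    case True
    then have "card (?A - {elt l}) + 1 = card ?A"
      using mem fS card_Suc_Diff1[of ?A "elt l"] by simp
    then show ?thesis using True unfolding forced_def forced_by_def eq by simp
  next
    case False
    then have "?A - {elt l} = ?A" using mem by blast
    then show ?thesis using False unfolding forced_def forced_by_def eq by simp
  qed
qed

lemma forced_by_le: "forced_by s l \<le> 1" by (simp add: forced_by_def)

lemma forced_by_eq_0: "side l \<noteq> s \<Longrightarrow> forced_by s l = 0"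
  using blocks_side[of l "Letter s z"] by (auto simp: forced_by_def)

lemma forced_sum:
  assumes S: "marked S"
  shows "forced True S + forced False S + 1 \<le> card S"
proof -
  note fS = marked_finite[OF S]
  let ?A = "\<lambda>s. {x \<in> S. blocks (Letter s x) (Letter s z)}"
  have "?A True \<inter> ?A False = {}" by (auto simp: blocks_def dest: lt_asym)
  then have "card (?A True) + card (?A False) = card (?A True \<union> ?A False)"
    using fS by (intro card_Un_disjoint[symmetric]) auto
  also have "\<dots> \<le> card (S - {z})"
    using fS by (intro card_mono) (auto simp: blocks_def lt_irrefl)
  also have "\<dots> = card S - 1" using S by (simp add: marked_def)
  finally have "forced True S + forced False S \<le> card S - 1" by (simp add: forced_def)
  moreover have "card S > 0" using S fS by (auto simp: marked_def card_gt_0_iff)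
  ultimately show ?thesis by linarith
qed

text \<open>Descend from \<open>x\<close> through blockers. The descent cannot meet
  \<open>z\<close>, since by transitivity \<open>z\<close> would then block \<open>x\<close>, and
  the number of blockers strictly decreases.\<close>

lemma exists_avail:
  assumes S: "marked S" and x: "x \<in> S" "x \<noteq> z" and zx: "\<not> blocks (Letter s z) (Letter s x)"
  shows "\<exists>l\<in>avail S. side l = s \<and> (elt l = x \<or> blocks l (Letter s x))"
  using x zx
proof (induction "card {y \<in> S. blocks (Letter s y) (Letter s x)}" arbitrary: x rule: less_induct)
  case less
  show ?case
  proof (cases "Letter s x \<in> avail S")
    case True
    then show ?thesis by (intro bexI[of _ "Letter s x"]) auto
  next
    case False
    then obtain y where y: "y \<in> S" "blocks (Letter s y) (Letter s x)"
      using less.prems by (auto simp: avail_def)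
    have yz: "y \<noteq> z" "\<not> blocks (Letter s z) (Letter s y)"
      using y less.prems blocks_trans by blast+
    have "{w \<in> S. blocks (Letter s w) (Letter s y)} \<subset> {w \<in> S. blocks (Letter s w) (Letter s x)}"
      using y blocks_trans blocks_irrefl by blast
    then have "card {w \<in> S. blocks (Letter s w) (Letter s y)} < card {w \<in> S. blocks (Letter s w) (Letter s x)}"
      using marked_finite[OF S] by (intro psubset_card_mono) auto
    from less.hyps[OF this y(1) yz] obtain l
      where "l \<in> avail S" "side l = s" "elt l = y \<or> blocks l (Letter s y)" by blast
    then show ?thesis
      using y(2) blocks_trans letter_eqI[of l "Letter s y"] by (intro bexI[of _ l]) auto
  qed
qed

lemma exists_forced_by:
  assumes S: "marked S" and c: "forced s S > 0"
  shows "\<exists>l\<in>avail S. blocks l (Letter s z)"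
proof -
  obtain x where x: "x \<in> S" "blocks (Letter s x) (Letter s z)"
    using c by (auto simp: forced_def card_gt_0_iff)
  then have "x \<noteq> z" "\<not> blocks (Letter s z) (Letter s x)" using blocks_irrefl blocks_asym by blast+
  from exists_avail[OF S x(1) this] obtain l
    where l: "l \<in> avail S" "side l = s" "elt l = x \<or> blocks l (Letter s x)" by blast
  then have "blocks l (Letter s z)"
    using x(2) blocks_trans letter_eqI[of l "Letter s x"] by auto
  then show ?thesis using l by blast
qed

text \<open>By counting, some element other than \<open>z\<close> is not forced to the opposite
  side; so \<open>z\<close> does not block it on side \<open>s\<close>, and a descent can start
  there.\<close>

lemma exists_avail_side:
  assumes S: "marked S" and c: "forced (\<not> s) S + 1 < card S"
  shows "\<exists>l\<in>avail S. side l = s"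
proof -
  note fS = marked_finite[OF S]
  let ?A = "{x \<in> S. blocks (Letter (\<not> s) x) (Letter (\<not> s) z)}"
  have "card (insert z ?A) < card S"
    using c card_insert_le_m1[of "card ?A + 1" ?A z] by (auto simp: forced_def)
  then have "\<not> S \<subseteq> insert z ?A"
    using card_mono[of "insert z ?A" S] fS by auto
  then obtain x where x: "x \<in> S" "x \<noteq> z" "\<not> blocks (Letter (\<not> s) x) (Letter (\<not> s) z)" by blast
  then have "\<not> blocks (Letter s z) (Letter s x)" using blocks_flip[of s z x] by simp
  from exists_avail[OF S x(1,2) this] show ?thesis by blast
qed

text \<open>Position \<open>p\<close> is possible exactly if the forced elements fit on both sides
  of \<open>z\<close>. Reading a letter on a side \<open>s\<close> that has a place left lowers the
  bound of that side by one; choosing a forced letter whenever there is one lowers the forced count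
  as well.\<close>

lemma N_pos_step:
  assumes S: "marked S" and p: "1 \<le> p" "p \<le> card S" and s: "if s then p \<ge> 2 else p < card S"
    and IH: "\<And>S' p'. marked S' \<Longrightarrow> card S' < card S \<Longrightarrow> 1 \<le> p' \<Longrightarrow> p' \<le> card S' \<Longrightarrow>
        N S' p' > 0 \<longleftrightarrow> forced True S' \<le> p' - 1 \<and> forced False S' \<le> card S' - p'"
  shows "N S p > 0 \<longleftrightarrow> forced True S \<le> p - 1 \<and> forced False S \<le> card S - p"
proof -
  note fS = marked_finite[OF S]
  let ?p = "if s then p - 1 else p"
  let ?A = "{l \<in> avail S. side l = s}"
  have IHl: "N (S - {elt l}) ?p > 0 \<longleftrightarrow>
      forced True (S - {elt l}) \<le> ?p - 1 \<and> forced False (S - {elt l}) \<le> card S - 1 - ?p" if "l \<in> avail S" for l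
  proof -
    have c: "card (S - {elt l}) = card S - 1" using avail_elt(1)[OF that] by simp
    show ?thesis
      using IH[OF marked_Diff[OF S that], of ?p] p s unfolding c by (auto split: if_splits)
  qed
  have "N S p = (\<Sum>l\<in>?A. wt l * N (S - {elt l}) ?p)"
    using s by (intro N_rec[OF S]) (auto split: if_splits)
  moreover have "wt l * N (S - {elt l}) ?p \<ge> 0" if "l \<in> avail S" for l
    using wt_pos[OF S that] N_nonneg[OF marked_Diff[OF S that]] by simp
  ultimately have "N S p > 0 \<longleftrightarrow> (\<exists>l\<in>?A. wt l * N (S - {elt l}) ?p > 0)"
    using finite_avail[OF fS] by (simp only:) (intro sum_pos_iff, auto)
  also have "\<dots> \<longleftrightarrow> (\<exists>l\<in>?A. N (S - {elt l}) ?p > 0)"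
  proof (rule bex_cong[OF refl])
    fix l assume "l \<in> ?A"
    then have "wt l > 0" using wt_pos[OF S] by simp
    then show "0 < wt l * N (S - {elt l}) ?p \<longleftrightarrow> 0 < N (S - {elt l}) ?p"
      using zero_less_mult_pos mult_pos_pos by blast
  qed
  also have "\<dots> \<longleftrightarrow> (\<exists>l\<in>?A. forced True (S - {elt l}) \<le> ?p - 1 \<and> forced False (S - {elt l}) \<le> card S - 1 - ?p)"
    using IHl by auto
  also have "\<dots> \<longleftrightarrow> forced True S \<le> p - 1 \<and> forced False S \<le> card S - p"
  proof
    assume "\<exists>l\<in>?A. forced True (S - {elt l}) \<le> ?p - 1 \<and> forced False (S - {elt l}) \<le> card S - 1 - ?p"
    then obtain l where l: "l \<in> avail S" "side l = s"
      and *: "forced True (S - {elt l}) \<le> ?p - 1" "forced False (S - {elt l}) \<le> card S - 1 - ?p" by blast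
    show "forced True S \<le> p - 1 \<and> forced False S \<le> card S - p"
      using forced_Diff[OF S l(1), of True] forced_Diff[OF S l(1), of False] * s p
        forced_by_le[of True l] forced_by_le[of False l] forced_by_eq_0[of l "\<not> s"] l(2)
      by (cases s) auto
  next
    assume a: "forced True S \<le> p - 1 \<and> forced False S \<le> card S - p"
    have "\<exists>l\<in>?A. forced s S > 0 \<longrightarrow> forced_by s l = 1"
    proof (cases "forced s S > 0")
      case True
      from exists_forced_by[OF S this] obtain l where l: "l \<in> avail S" "blocks l (Letter s z)" by blast
      then show ?thesis using blocks_side[OF l(2)] by (intro bexI[of _ l]) (auto simp: forced_by_def)
    next
      case False
      have "forced (\<not> s) S + 1 < card S" using a s p by (cases s) auto
      from exists_avail_side[OF S this] show ?thesis using False by auto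
    qed
    then obtain l where "l \<in> ?A" and l3: "forced s S > 0 \<longrightarrow> forced_by s l = 1" by (elim bexE)
    then have l: "l \<in> avail S" "side l = s" by simp_all
    have "forced True (S - {elt l}) \<le> ?p - 1 \<and> forced False (S - {elt l}) \<le> card S - 1 - ?p"
    proof (cases s)
      case True
      then have "forced True S > 0 \<longrightarrow> forced_by True l = 1" "p \<ge> 2" using l3 s by simp_all
      then show ?thesis
        using True forced_Diff[OF S l(1), of True] forced_Diff[OF S l(1), of False] a p by simp linarith
    next
      case False
      then have "forced False S > 0 \<longrightarrow> forced_by False l = 1" "p < card S" using l3 s by simp_all
      then show ?thesis
        using False forced_Diff[OF S l(1), of True] forced_Diff[OF S l(1), of False] a p by simp linarith
    qed
    then show "\<exists>l\<in>?A. forced True (S - {elt l}) \<le> ?p - 1 \<and> forced False (S - {elt l}) \<le> card S - 1 - ?p"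
      using \<open>l \<in> ?A\<close> by (rule bexI)
  qed
  finally show ?thesis .
qed

lemma N_pos_iff:
  assumes "marked S" "1 \<le> p" "p \<le> card S"
  shows "N S p > 0 \<longleftrightarrow> forced True S \<le> p - 1 \<and> forced False S \<le> card S - p"
  using assms
proof (induction "card S" arbitrary: S p rule: less_induct)
  case less
  consider "p \<ge> 2" | "p < card S" | "p = 1" "card S = 1" using less.prems by linarith
  then show ?case
  proof cases
    case 1
    have "if True then p \<ge> 2 else p < card S" using 1 by simp
    from N_pos_step[OF less.prems this] show ?thesis using less.hyps by blast
  next
    case 2
    have "if False then p \<ge> 2 else p < card S" using 2 by simp
    from N_pos_step[OF less.prems this] show ?thesis using less.hyps by blast
  next
    case 3
    then obtain x where "S = {x}" using card_1_singletonE by blast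
    then have "S = {z}" using less.prems(1) by (simp add: marked_def)
    moreover have "forced s {z} = 0" for s by (simp add: forced_def blocks_irrefl)
    ultimately show ?thesis using 3 weighted_count_singleton[of z r \<omega>] by simp
  qed
qed

text \<open>The conditions for the two positions together cover the stated range except for the
  corner where both bounds are attained, and \<open>forced_sum\<close> rules that corner
  out.\<close>

lemma N_mix_pos_iff:
  assumes S: "marked S" and q: "1 \<le> q" "Suc q \<le> card S" and t: "0 < t" "t < 1"
  shows "N_mix t q S > 0 \<longleftrightarrow> forced True S \<le> q \<and> forced False S \<le> card S - q"
proof -
  have nn: "t * N S (Suc q) \<ge> 0" "(1 - t) * N S q \<ge> 0"
    using N_nonneg[OF S] t by simp_all
  have "N_mix t q S > 0 \<longleftrightarrow> t * N S (Suc q) > 0 \<or> (1 - t) * N S q > 0"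
    using nn unfolding N_mix_def by linarith
  also have "\<dots> \<longleftrightarrow> N S (Suc q) > 0 \<or> N S q > 0"
    using t by (simp add: zero_less_mult_iff)
  also have "\<dots> \<longleftrightarrow> forced True S \<le> q \<and> forced False S \<le> card S - q"
    using N_pos_iff[OF S, of q] N_pos_iff[OF S, of "Suc q"] q forced_sum[OF S] by auto
  finally show ?thesis .
qed

lemma N_mix_nonneg: "marked S \<Longrightarrow> 0 < t \<Longrightarrow> t < 1 \<Longrightarrow> N_mix t q S \<ge> 0"
  by (simp add: N_mix_def N_nonneg)

section \<open>Irreducibility of the mixed matrices\<close>

text \<open>The bounds of \<open>N_mix_pos_iff\<close> for a set of \<open>m - 2\<close> elements,
  which is what remains after reading two letters.\<close>

definition room :: "nat \<Rightarrow> nat \<Rightarrow> bool \<Rightarrow> nat" where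
  "room m q s = (if s then q else m - 2 - q)"

lemma C_mix_pos:
  assumes S: "marked S" and q: "1 \<le> q" "q + 3 \<le> card S" and t: "0 < t" "t < 1"
    and ij: "i \<in> avail S" "j \<in> avail S" "elt i \<noteq> elt j"
    and le: "\<And>s. forced s S \<le> room (card S) q s + forced_by s i + forced_by s j"
  shows "C (N_mix t q) S i j > 0"
proof -
  note m1 = marked_Diff[OF S ij(1)]
  have j: "j \<in> avail (S - {elt i})" by (rule avail_Diff(1)[OF ij])
  note m2 = marked_Diff[OF m1 j]
  have c: "card (S - {elt i} - {elt j}) = card S - 2"
    using avail_elt(1)[OF ij(1)] avail_elt(1)[OF j] by (simp add: card_Diff_singleton)
  have "forced s (S - {elt i} - {elt j}) \<le> room (card S) q s" for s
    using le[of s] forced_Diff[OF S ij(1), of s] forced_Diff[OF m1 j, of s] by linarith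
  from this[of True] this[of False]
  have "N_mix t q (S - {elt i} - {elt j}) > 0"
    using q by (subst N_mix_pos_iff[OF m2 q(1) _ t]) (auto simp: c room_def)
  then show ?thesis
    using wt_pos[OF S ij(1)] wt_pos[OF S ij(2)] ij(3) by (auto simp: C_def)
qed

text \<open>A nonzero row has a word \<open>i j\<close> whose remaining set obeys the bounds, and
  \<open>j\<close> can account for at most one of the forced elements removed.\<close>

lemma C_mix_support:
  assumes S: "marked S" and q: "1 \<le> q" "q + 3 \<le> card S" and t: "0 < t" "t < 1"
    and i: "i \<in> avail S" and row: "(\<Sum>j\<in>avail S. C (N_mix t q) S i j * mixvec t j) > 0"
  shows "forced s S \<le> room (card S) q s + 1 + forced_by s i"
proof -
  note m1 = marked_Diff[OF S i]
  obtain j where j: "j \<in> avail (S - {elt i})" and pos: "N_mix t q (S - {elt i} - {elt j}) \<noteq> 0"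
    using row unfolding C_row[OF marked_finite[OF S] i]
    by (metis (no_types, lifting) mult_zero_left mult_zero_right order_less_irrefl sum.neutral)
  note m2 = marked_Diff[OF m1 j]
  have c: "card (S - {elt i} - {elt j}) = card S - 2"
    using avail_elt(1)[OF i] avail_elt(1)[OF j] by (simp add: card_Diff_singleton)
  have "N_mix t q (S - {elt i} - {elt j}) > 0"
    using pos N_mix_nonneg[OF m2 t, of q] by linarith
  then have "forced True (S - {elt i} - {elt j}) \<le> q \<and> forced False (S - {elt i} - {elt j}) \<le> card S - 2 - q"
    using q by (subst (asm) N_mix_pos_iff[OF m2 q(1) _ t]) (auto simp: c)
  then have "forced s (S - {elt i} - {elt j}) \<le> room (card S) q s" by (cases s) (auto simp: room_def)
  then show ?thesis
    using forced_Diff[OF S i, of s] forced_Diff[OF m1 j, of s] forced_by_le[of s j] by linarith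
qed

text \<open>Both letters of \<open>elt i\<close> are available, so \<open>elt i\<close> is
  comparable to no other element of \<open>S\<close>, and a descent from a third element cannot end
  there.\<close>

lemma exists_avail_other:
  assumes S: "marked S" and c: "card S \<ge> 3"
    and ij: "i \<in> avail S" "j \<in> avail S" "elt i = elt j" "i \<noteq> j"
  shows "\<exists>l\<in>avail S. elt l \<noteq> elt i"
proof -
  have "card {z, elt i} \<le> 2" by (simp add: card_insert_if)
  then have "\<not> S \<subseteq> {z, elt i}" using c card_mono[of "{z, elt i}" S] by auto
  then obtain y where y: "y \<in> S" "y \<noteq> z" "y \<noteq> elt i" by blast
  have both: "Letter s (elt i) \<in> avail S" for s
  proof -
    have "side i \<noteq> side j" using ij(3,4) letter_eqI by blast
    then have "Letter s (elt i) = i \<or> Letter s (elt i) = j"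
      using ij(3) by (cases i; cases j) auto
    then show ?thesis using ij(1,2) by auto
  qed
  \<comment> \<open>Since \<open>z\<close> cannot lie both below and above \<open>y\<close>, the
    descent from \<open>y\<close> has a side on which \<open>z\<close> does not block it.\<close>
  have "\<not> blocks (Letter True z) (Letter True y) \<or> \<not> blocks (Letter False z) (Letter False y)"
    using blocks_flip[of False z y] blocks_asym[of "Letter True z" "Letter True y"] by simp
  then obtain s where "\<not> blocks (Letter s z) (Letter s y)" by blast
  from exists_avail[OF S y(1,2) this] obtain l
    where l: "l \<in> avail S" "side l = s" "elt l = y \<or> blocks l (Letter s y)" by blast
  have "elt l \<noteq> elt i"
  proof
    assume "elt l = elt i"
    then have "blocks (Letter s (elt i)) (Letter s y)" using l y by (cases l) auto
    then have "blocks (Letter (\<not> s) y) (Letter (\<not> s) (elt i))" using blocks_flip by blast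
    then show False using avail_not_blocks[OF both[of "\<not> s"], of "Letter (\<not> s) y"] y by simp
  qed
  then show ?thesis using l by blast
qed

text \<open>
  Either all pairs of distinct elements are adjacent, or exactly one side \<open>s\<close> has more forced
  elements than \<open>room\<close>: then a letter of an element forced on side \<open>s\<close> is adjacent to everything, or
  (with an excess of 2) all nonzero rows belong to such letters.
\<close>

lemma C_mix_connected:
  assumes S: "marked S" and q: "1 \<le> q" "q + 3 \<le> card S" and t: "0 < t" "t < 1"
    and ij: "i \<in> avail S" "j \<in> avail S"
    and rows: "(\<Sum>l\<in>avail S. C (N_mix t q) S i l * mixvec t l) > 0"
      "(\<Sum>l\<in>avail S. C (N_mix t q) S j l * mixvec t l) > 0"
  shows "i = j \<or> C (N_mix t q) S i j > 0 \<or>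
    (\<exists>l\<in>avail S. C (N_mix t q) S i l > 0 \<and> C (N_mix t q) S l j > 0)"
proof (cases "\<forall>s. forced s S \<le> room (card S) q s")
  case True
  have adj: "C (N_mix t q) S k l > 0" if "k \<in> avail S" "l \<in> avail S" "elt k \<noteq> elt l" for k l
    using True that by (intro C_mix_pos[OF S q t]) (auto intro: trans_le_add1)
  show ?thesis
  proof (cases "elt i = elt j \<and> i \<noteq> j")
    case True
    then obtain l where "l \<in> avail S" "elt l \<noteq> elt i"
      using exists_avail_other[OF S _ ij] q by auto
    then show ?thesis using adj ij True by metis
  qed (use adj ij in blast)
next
  case False
  then obtain s where big: "forced s S > room (card S) q s" by (auto simp: not_le)
  \<comment> \<open>If both sides exceeded their room, there would be at least \<open>card S\<close>
    forced elements, one more than the elements other than \<open>z\<close>.\<close>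
  have other: "forced s' S \<le> room (card S) q s'" if "s' \<noteq> s" for s'
    using forced_sum[OF S] big that q by (cases s; cases s') (auto simp: room_def)
  have supp: "forced s S \<le> room (card S) q s + 1 + forced_by s i" "forced s S \<le> room (card S) q s + 1 + forced_by s j"
    using C_mix_support[OF S q t] ij rows by blast+
  show ?thesis
  proof (cases "forced s S = room (card S) q s + 1")
    case True
    from exists_forced_by[OF S, of s] big obtain l
      where l: "l \<in> avail S" "blocks l (Letter s z)" by auto
    then have side: "side l = s" and d: "forced_by s l = 1" using blocks_side[OF l(2)] by (auto simp: forced_by_def)
    have adj: "C (N_mix t q) S l k > 0" if k: "k \<in> avail S" "k \<noteq> l" for k
    proof (rule C_mix_pos[OF S q t l(1) k(1)])
      show "elt l \<noteq> elt k"
      proof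
        \<comment> \<open>The opposite letter of a forced element is blocked by \<open>z\<close>, so
          \<open>k\<close> cannot be that letter.\<close>
        assume e: "elt l = elt k"
        then have "side k \<noteq> s" using k(2) side letter_eqI by metis
        then have "k = Letter (\<not> s) (elt l)" using e by (cases k) auto
        moreover have "blocks (Letter (\<not> s) z) (Letter (\<not> s) (elt l))"
          using l(2) side blocks_flip[of s "elt l" z] by (cases l) auto
        ultimately show False using not_blocks_marked[OF S k(1)] by simp
      qed
      show "forced s' S \<le> room (card S) q s' + forced_by s' l + forced_by s' k" for s'
        using other[of s'] True d by (cases "s' = s") auto
    qed
    show ?thesis using adj ij l(1) C_sym by metis
  next
    case False
    then have d: "forced_by s i = 1" "forced_by s j = 1" "forced s S = room (card S) q s + 2"
      using supp big forced_by_le[of s i] forced_by_le[of s j] by linarith+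
    then have "side i = s" "side j = s" using forced_by_eq_0 by force+
    then have "elt i \<noteq> elt j" if "i \<noteq> j" using that letter_eqI by metis
    moreover have "forced s' S \<le> room (card S) q s' + forced_by s' i + forced_by s' j" for s'
      using other[of s'] d by (cases "s' = s") auto
    ultimately show ?thesis using C_mix_pos[OF S q t ij] by blast
  qed
qed

section \<open>The induction step\<close>

lemma B_mix: "B (N_mix t q) S u v = t * B (\<lambda>S. N S (Suc q)) S u v + (1 - t) * B (\<lambda>S. N S q) S u v"
proof -
  have "C (N_mix t q) S i j = t * C (\<lambda>S. N S (Suc q)) S i j + (1 - t) * C (\<lambda>S. N S q) S i j" for i j
    unfolding C_def N_mix_def by (simp add: sum_distrib_left sum.distrib[symmetric] algebra_simps)
  then show ?thesis
    unfolding bform_def sum_distrib_left sum.distrib[symmetric]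
    by (intro sum.cong refl) (simp only: distrib_right distrib_left mult_ac)
qed

text \<open>A sum of nonnegative entries times positive coefficients vanishes only if every entry
  does. This handles the rows of sum 0, on which the inductive inequality gives no bound.\<close>

lemma B_eq_0:
  assumes S: "marked S" and G: "\<And>S'. marked S' \<Longrightarrow> G S' \<ge> 0"
    and h: "\<And>i. h i > 0" and z: "B G S h h = 0"
  shows "B G S u v = 0"
proof -
  have "C G S i j * h i * h j = 0" if "i \<in> avail S" "j \<in> avail S" for i j
  proof -
    have nn: "C G S i j * h i * h j \<ge> 0" if "i \<in> avail S" "j \<in> avail S" for i j
      using C_nonneg[of S i j G] S G that h[of i] h[of j] by simp
    have "\<forall>i\<in>avail S. (\<Sum>j\<in>avail S. C G S i j * h i * h j) = 0"
      using z nn finite_avail[OF marked_finite[OF S]] unfolding bform_def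
      by (subst (asm) sum_nonneg_eq_0_iff) (auto intro!: sum_nonneg)
    then have "(\<Sum>j\<in>avail S. C G S i j * h i * h j) = 0" using that by blast
    then show ?thesis
      using nn that finite_avail[OF marked_finite[OF S]]
      by (subst (asm) sum_nonneg_eq_0_iff) auto
  qed
  then have "C G S i j = 0" if "i \<in> avail S" "j \<in> avail S" for i j
    using that h[of i] h[of j] by force
  then show ?thesis unfolding bform_def by (auto intro!: sum.neutral)
qed

text \<open>The local-global principle with \<open>h\<close> the coefficients of the mixed recursion
  and \<open>q i\<close> the transported form of \<open>S\<close> without \<open>elt i\<close>,
  taken at the single position \<open>q\<close> for every \<open>i\<close>.\<close>

lemma hyperbolic_mix:
  assumes S: "marked S" and q: "1 \<le> q" "q + 3 \<le> card S" and t: "0 < t" "t < 1"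
    and IH: "\<And>i. i \<in> avail S \<Longrightarrow> hyperbolic (B (\<lambda>S. N S q) (S - {elt i}))"
  shows "hyperbolic (B (N_mix t q) S)"
proof -
  note fS = marked_finite[OF S]
  let ?h = "mixvec t"
  let ?G = "N_mix t q"
  let ?B' = "\<lambda>i. B (\<lambda>S. N S q) (S - {elt i})"
  define Q where "Q i v = wt i * ?B' i (transport i v) (transport i v)" for i v
  have hpos: "?h i > 0" for i using t by (simp add: mixvec_def)
  have hside: "?h i = ?h j" if "side i = side j" for i j using that by (simp add: mixvec_def)
  have G: "?G (S - {elt i} - {elt j})
      = (\<Sum>l\<in>avail (S - {elt i} - {elt j}). ?h l * wt l * N (S - {elt i} - {elt j} - {elt l}) q)"
    if i: "i \<in> avail S" and j: "j \<in> avail (S - {elt i})" for i j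
  proof (rule N_mix_rec)
    show "marked (S - {elt i} - {elt j})" by (rule marked_Diff[OF marked_Diff[OF S i] j])
    have "card (S - {elt i} - {elt j}) = card S - 2"
      using avail_elt(1)[OF i] avail_elt(1)[OF j] by (simp add: card_Diff_singleton)
    then show "q \<noteq> card (S - {elt i} - {elt j})" using q by linarith
  qed (rule q(1))
  have inh: "(\<Sum>j\<in>avail S. C ?G S i j * v j) = wt i * ?B' i (transport i v) ?h" if i: "i \<in> avail S" for i v
    by (rule C_inherit[OF fS i hside G[OF i]])
  have th: "transport i ?h = ?h" for i
    unfolding transport_def using hside[OF blocks_side] by (intro ext) metis
  show ?thesis
  proof (rule hyperbolic_local_global[where h = ?h and q = Q])
    show "finite (avail S)" by (rule finite_avail[OF fS])
    show "C ?G S i j = C ?G S j i" for i j by (rule C_sym)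
    show "C ?G S i j \<ge> 0" if "i \<in> avail S" "j \<in> avail S" for i j
      using that by (intro C_nonneg S N_mix_nonneg t)
    show "?h i > 0" for i by (rule hpos)
    show "Q i v * (\<Sum>j\<in>avail S. C ?G S i j * ?h j) \<le> (\<Sum>j\<in>avail S. C ?G S i j * v j)\<^sup>2"
      if i: "i \<in> avail S" for i v
    proof -
      have "?B' i ?h ?h \<ge> 0"
        unfolding bform_def using hpos
        by (intro sum_nonneg mult_nonneg_nonneg C_nonneg marked_Diff[OF S i] N_nonneg) (auto intro: less_imp_le)
      then have "?B' i (transport i v) (transport i v) * ?B' i ?h ?h \<le> (?B' i (transport i v) ?h)\<^sup>2"
        using IH[OF i] by (simp add: hyperbolic_def)
      then have "(wt i)\<^sup>2 * (?B' i (transport i v) (transport i v) * ?B' i ?h ?h)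
          \<le> (wt i)\<^sup>2 * (?B' i (transport i v) ?h)\<^sup>2"
        by (intro mult_left_mono) auto
      then show ?thesis
        unfolding inh[OF i] Q_def th by (simp add: power2_eq_square mult_ac)
    qed
    show "Q i v \<le> 0" if i: "i \<in> avail S" and z: "(\<Sum>j\<in>avail S. C ?G S i j * ?h j) = 0" for i v
    proof -
      have hz: "?B' i ?h ?h = 0" using z wt_pos[OF S i] unfolding inh[OF i] th by simp
      have "?B' i (transport i v) (transport i v) = 0"
        by (rule B_eq_0[where G = "\<lambda>S. N S q" and h = ?h, OF marked_Diff[OF S i] N_nonneg hpos hz])
      then show ?thesis by (simp add: Q_def)
    qed
    show "B ?G S v v \<le> (\<Sum>i\<in>avail S. ?h i * Q i v)" for v
      unfolding Q_def by (rule C_pull[OF S hside less_imp_le[OF hpos] N_nonneg G])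
    show "i = j \<or> C ?G S i j > 0 \<or> (\<exists>l\<in>avail S. C ?G S i l > 0 \<and> C ?G S l j > 0)"
      if "i \<in> avail S" "j \<in> avail S" "(\<Sum>l\<in>avail S. C ?G S i l * ?h l) > 0"
        "(\<Sum>l\<in>avail S. C ?G S j l * ?h l) > 0" for i j
      using C_mix_connected[OF S q t] that by blast
  qed
qed

section \<open>Sets of three elements\<close>

lemma hyperbolic_base_incomparable:
  assumes S: "marked S" "S = {x, y, z}" and xy: "x \<noteq> y" "x \<noteq> z" "y \<noteq> z"
    and nlt: "\<not> lt x y" "\<not> lt y x"
  shows "hyperbolic (B (\<lambda>S. N S 1) S)"
proof -
  note fS = marked_finite[OF S(1)]
  define G where "G = (\<lambda>S. N S 1)"
  have Gz: "G {z} = 1" by (simp only: G_def weighted_count_singleton)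
  let ?C = "C G S"
  let ?A = "\<lambda>x. {i \<in> avail S. elt i = x}"
  define f where "f a u = (\<Sum>i\<in>?A a. wt i * u i)" for a :: 'a and u :: "'a letter \<Rightarrow> real"
  have fA: "finite (?A a)" for a using finite_avail[OF fS] by simp
  have un: "avail S = ?A x \<union> ?A y" using S(2) avail_elt by blast
  have same: "?C i j = 0" if ij: "i \<in> avail S" "j \<in> avail S" "elt i = elt j" for i j
  proof -
    have "\<not> blocks i l" if l: "l \<in> avail (S - {elt i})" for l
    proof -
      have "elt i \<in> {x, y}" "elt l \<in> {x, y}" "elt l \<noteq> elt i"
        using avail_elt[OF ij(1)] avail_elt[OF l] S(2) by auto
      then show ?thesis using nlt by (auto simp: blocks_def)
    qed
    then have e: "{l \<in> avail (S - {elt i}). blocks i l} = {}" by blast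
    show ?thesis
    proof (cases "i = j")
      case True
      then show ?thesis unfolding C_def using e by (simp only: refl if_True sum.empty)
    qed (simp add: C_def ij(3))
  qed
  have diff: "?C i j = wt i * wt j" if ij: "i \<in> ?A a" "j \<in> ?A b" "{a, b} = {x, y}" for i j a b
  proof -
    have "elt i \<noteq> elt j" "S - {elt i} - {elt j} = {z}" using ij xy S(2) by auto
    then show ?thesis using Gz by (auto simp: C_def)
  qed
  have split: "sum g (avail S) = sum g (?A x) + sum g (?A y)" for g :: "'a letter \<Rightarrow> real"
  proof -
    have "sum g (avail S) = sum g (?A x \<union> ?A y)" by (rule arg_cong[OF un])
    also have "\<dots> = sum g (?A x) + sum g (?A y)"
      using xy(1) by (intro sum.union_disjoint fA) auto
    finally show ?thesis .
  qed
  \<comment> \<open>Nothing blocks between \<open>x\<close> and \<open>y\<close>, so letters of the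
    same element never interact, and letters of different elements give the product of their
    weights: the form is a symmetrised product of two functionals.\<close>
  have "B G S u v = f x u * f y v + f y u * f x v" for u v
  proof -
    have e: "(\<Sum>i\<in>?A a. \<Sum>j\<in>?A a. ?C i j * u i * v j) = 0" for a
    proof (intro sum.neutral ballI)
      fix i j assume "i \<in> ?A a" "j \<in> ?A a"
      then have "?C i j = 0" by (intro same) auto
      then show "?C i j * u i * v j = 0" by simp
    qed
    have d: "(\<Sum>i\<in>?A a. \<Sum>j\<in>?A b. ?C i j * u i * v j) = f a u * f b v" if "{a, b} = {x, y}" for a b
      unfolding f_def sum_product
    proof (intro sum.cong refl)
      fix i j assume "i \<in> ?A a" "j \<in> ?A b"
      from diff[OF this that] show "?C i j * u i * v j = wt i * u i * (wt j * v j)"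
        by (simp only: mult_ac)
    qed
    show ?thesis
      unfolding bform_def split sum.distrib using e d[of x y] d[of y x] by (simp add: insert_commute)
  qed
  then have "hyperbolic (B G S)"
    by (intro hyperbolic_binary[where f = "f x" and g = "f y" and \<alpha> = 0 and \<beta> = 1 and \<gamma> = 0]) auto
  then show ?thesis by (simp only: G_def)
qed

text \<open>Only the first letter of \<open>x\<close> and the last letter of \<open>y\<close> can be
  available. The off-diagonal entry is \<open>\<omega> x\<close> and the diagonal entries are at
  most \<open>\<omega> x * \<omega> y\<close> and 1, so the determinant is nonpositive because
  \<open>\<omega> y \<le> \<omega> x\<close>.\<close>

lemma hyperbolic_base_comparable:
  assumes S: "marked S" "S = {x, y, z}" and xy: "x \<noteq> y" "x \<noteq> z" "y \<noteq> z"
    and l: "lt x y" and mono: "\<omega> y \<le> \<omega> x"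
  shows "hyperbolic (B (\<lambda>S. N S 1) S)"
proof -
  have pxy: "\<omega> x > 0" "\<omega> y > 0" using S pos by (auto simp: marked_def)
  define G where "G = (\<lambda>S. N S 1)"
  have Gz: "G {z} = 1" by (simp only: G_def weighted_count_singleton)
  let ?C = "C G S"
  define a where "a = Letter True x"
  define b where "b = Letter False y"
  have ab: "a \<noteq> b" "elt a = x" "elt b = y" "side a" "\<not> side b" by (auto simp: a_def b_def)
  have sub: "avail S \<subseteq> {a, b}"
  proof
    fix i assume i: "i \<in> avail S"
    have "elt i \<in> {x, y}" using avail_elt[OF i] S(2) by auto
    moreover have "i \<noteq> Letter True y"
      using avail_not_blocks[OF i, of "Letter True x"] S(2) l by (auto simp: blocks_def)
    moreover have "i \<noteq> Letter False x"
      using avail_not_blocks[OF i, of "Letter False y"] S(2) l by (auto simp: blocks_def)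
    ultimately show "i \<in> {a, b}" by (cases i; cases "side i") (auto simp: a_def b_def)
  qed
  define ind where "ind i = (if i \<in> avail S then 1 else 0 :: real)" for i
  have diag: "0 \<le> ?C i i \<and> ?C i i \<le> wt i * wt l'"
    if i: "i \<in> avail S" and s: "{l \<in> avail (S - {elt i}). blocks i l} \<subseteq> {l'}" and w: "wt l' > 0"
      and e: "S - {elt i} - {elt l'} = {z}" for i l'
  proof -
    consider "{l \<in> avail (S - {elt i}). blocks i l} = {}" | "{l \<in> avail (S - {elt i}). blocks i l} = {l'}"
      using s by blast
    then show ?thesis
    proof cases
      case 1
      then have "?C i i = 0" unfolding C_def by (simp only: refl if_True sum.empty)
      then show ?thesis using wt_pos[OF S(1) i] w by simp
    next
      case 2
      then have "?C i i = wt i * wt l' * G (S - {elt i} - {elt l'})"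
        unfolding C_def by (simp only: refl if_True) simp
      then show ?thesis using wt_pos[OF S(1) i] w by (simp add: e Gz)
    qed
  qed
  have Caa: "0 \<le> ?C a a \<and> ?C a a \<le> \<omega> x * \<omega> y" if a: "a \<in> avail S"
  proof -
    have "{l \<in> avail (S - {elt a}). blocks a l} \<subseteq> {Letter True y}"
    proof
      fix m assume m: "m \<in> {l \<in> avail (S - {elt a}). blocks a l}"
      then have "elt m = y" "side m" using avail_elt[of m "S - {elt a}"] S(2) ab blocks_side[of a m] by auto
      then show "m \<in> {Letter True y}" by (cases m) auto
    qed
    moreover have "S - {elt a} - {elt (Letter True y)} = {z}" using S(2) xy ab by auto
    ultimately show ?thesis using diag[OF a, of "Letter True y"] pxy by (simp add: wt_def ab)
  qed
  have Cbb: "0 \<le> ?C b b \<and> ?C b b \<le> 1" if b: "b \<in> avail S"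
  proof -
    have "{l \<in> avail (S - {elt b}). blocks b l} \<subseteq> {Letter False x}"
    proof
      fix m assume m: "m \<in> {l \<in> avail (S - {elt b}). blocks b l}"
      then have "elt m = x" "\<not> side m" using avail_elt[of m "S - {elt b}"] S(2) ab blocks_side[of b m] by auto
      then show "m \<in> {Letter False x}" by (cases m) auto
    qed
    moreover have "S - {elt b} - {elt (Letter False x)} = {z}" using S(2) xy ab by auto
    ultimately show ?thesis using diag[OF b, of "Letter False x"] by (simp add: wt_def ab)
  qed
  have Cab: "?C a b = \<omega> x" "?C b a = \<omega> x"
  proof -
    have "S - {x} - {y} = {z}" using S(2) xy by auto
    then show "?C a b = \<omega> x" using xy(1) ab Gz
      by (simp add: C_def wt_def)
    then show "?C b a = \<omega> x" using C_sym by metis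
  qed
  have "B G S u v
      = (ind a * ?C a a) * u a * v a + (ind a * ind b * \<omega> x) * (u a * v b + u b * v a) + (ind b * ?C b b) * u b * v b"
    for u v
  proof -
    have "B G S u v = (\<Sum>i\<in>{a, b}. \<Sum>j\<in>{a, b}. ind i * ind j * ?C i j * u i * v j)"
    proof -
      have "B G S u v = (\<Sum>i\<in>avail S. \<Sum>j\<in>avail S. ind i * ind j * ?C i j * u i * v j)"
        unfolding bform_def by (intro sum.cong refl) (simp add: ind_def)
      also have "\<dots> = (\<Sum>i\<in>avail S. \<Sum>j\<in>{a, b}. ind i * ind j * ?C i j * u i * v j)"
        using sub by (intro sum.cong refl sum.mono_neutral_left) (auto simp: ind_def)
      also have "\<dots> = (\<Sum>i\<in>{a, b}. \<Sum>j\<in>{a, b}. ind i * ind j * ?C i j * u i * v j)"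
        using sub by (intro sum.mono_neutral_left) (auto simp: ind_def)
      finally show ?thesis .
    qed
    then show ?thesis using ab(1) Cab by (auto simp: ind_def algebra_simps)
  qed
  then have "hyperbolic (B G S)"
  proof (rule hyperbolic_binary)
    show "(ind a * ?C a a) * (ind b * ?C b b) \<le> (ind a * ind b * \<omega> x)\<^sup>2"
    proof (cases "a \<in> avail S \<and> b \<in> avail S")
      case True
      have "?C a a * ?C b b \<le> (\<omega> x * \<omega> y) * 1"
        using Caa Cbb True pxy by (intro mult_mono) auto
      also have "\<dots> \<le> (\<omega> x)\<^sup>2" using mono pxy by (simp add: power2_eq_square)
      finally show ?thesis using True by (simp add: ind_def)
    qed (auto simp: ind_def)
  qed
  then show ?thesis by (simp only: G_def)
qed

section \<open>The induction and the evaluation at the two sides\<close>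

text \<open>Three elements leave only \<open>q = 1\<close>. In a larger set every position is the
  lower end of a mixture, except the largest, \<open>q = card S - 2\<close>, which is the upper end
  of the mixture below it.\<close>

lemma hyperbolic_N:
  assumes mono: "\<And>x y. x \<in> X \<Longrightarrow> y \<in> X \<Longrightarrow> (x, y) \<in> r \<Longrightarrow> \<omega> x \<ge> \<omega> y"
    and S: "marked S" and q: "1 \<le> q" "q + 2 \<le> card S"
  shows "hyperbolic (B (\<lambda>S. N S q) S)"
  using S q
proof (induction "card S" arbitrary: S q rule: less_induct)
  case less
  show ?case
  proof (cases "card S = 3")
    case True
    have zS: "z \<in> S" and SX: "S \<subseteq> X" using less.prems(1) by (auto simp: marked_def)
    have "card (S - {z}) = 2" using True zS by simp
    then obtain x y where "S - {z} = {x, y}" "x \<noteq> y" by (auto simp: card_2_iff)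
    then have S: "S = {x, y, z}" and xy: "x \<noteq> y" "x \<noteq> z" "y \<noteq> z" using zS by auto
    have S': "S = {y, x, z}" using S by auto
    have q: "q = 1" using less.prems True by simp
    have X: "x \<in> X" "y \<in> X" using S SX by auto
    consider "lt x y" | "lt y x" | "\<not> lt x y" "\<not> lt y x" by blast
    then show ?thesis
    proof cases
      case 1
      then have "\<omega> y \<le> \<omega> x" using mono X by (simp add: lt_def)
      then show ?thesis unfolding q by (rule hyperbolic_base_comparable[OF less.prems(1) S xy 1])
    next
      case 2
      then have "\<omega> x \<le> \<omega> y" using mono X by (simp add: lt_def)
      then show ?thesis unfolding q
        by (rule hyperbolic_base_comparable[OF less.prems(1) S' xy(1)[symmetric] xy(3,2) 2])
    next
      case 3
      then show ?thesis unfolding q by (rule hyperbolic_base_incomparable[OF less.prems(1) S xy])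
    qed
  next
    case False
    have IH: "hyperbolic (B (\<lambda>S. N S q') (S - {elt i}))"
      if "i \<in> avail S" "1 \<le> q'" "q' + 3 \<le> card S" for i q'
    proof (rule less.hyps)
      have "card (S - {elt i}) = card S - 1" using avail_elt(1)[OF that(1)] by simp
      then show "card (S - {elt i}) < card S" "q' + 2 \<le> card (S - {elt i})" using that by linarith+
      show "marked (S - {elt i})" by (rule marked_Diff[OF less.prems(1) that(1)])
    qed (rule that(2))
    have mix: "hyperbolic (\<lambda>u v. t * B (\<lambda>S. N S (Suc q')) S u v + (1 - t) * B (\<lambda>S. N S q') S u v)"
      if "1 \<le> q'" "q' + 3 \<le> card S" "0 < t" "t < 1" for q' t
      using hyperbolic_mix[OF less.prems(1) that IH] that unfolding B_mix[abs_def] by blast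
    show ?thesis
    proof (cases "q + 3 \<le> card S")
      case True
      show ?thesis by (rule hyperbolic_limits(2)) (rule mix[OF less.prems(2) True])
    next
      case ge: False
      then obtain q' where q': "q = Suc q'" "1 \<le> q'" "q' + 3 \<le> card S"
        using less.prems False by (cases q) auto
      show ?thesis unfolding q'(1) by (rule hyperbolic_limits(1)) (rule mix[OF q'(2,3)])
    qed
  qed
qed

definition side_ind :: "bool \<Rightarrow> 'a letter \<Rightarrow> real" where
  "side_ind s l = (if side l = s then 1 else 0)"

lemma sum_side_N:
  assumes "marked S" "1 \<le> q" "q \<noteq> card S"
  shows "(\<Sum>l\<in>avail S. wt l * side_ind s l * N (S - {elt l}) q) = N S (q + of_bool s)"
proof -
  have "(\<Sum>l\<in>avail S. wt l * side_ind s l * N (S - {elt l}) q)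
      = (\<Sum>l\<in>{l \<in> avail S. side l = s}. wt l * side_ind s l * N (S - {elt l}) q)"
    by (intro sum.mono_neutral_right finite_avail marked_finite assms) (auto simp: side_ind_def)
  also have "\<dots> = (\<Sum>l\<in>{l \<in> avail S. side l = s}. wt l * N (S - {elt l}) q)"
    by (intro sum.cong refl) (simp add: side_ind_def)
  also have "\<dots> = N S (q + of_bool s)"
    using assms by (subst N_rec[OF assms(1), of s]) auto
  finally show ?thesis .
qed

text \<open>At these vectors the form counts extensions with the sides of two successive letters
  prescribed, and each letter below \<open>z\<close> raises the position of \<open>z\<close> by
  one.\<close>

lemma B_side_ind:
  assumes S: "marked S" and q: "1 \<le> q" "q + 2 \<le> card S"
  shows "B (\<lambda>S. N S q) S (side_ind s) (side_ind s') = N S (q + of_bool s' + of_bool s)"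
proof -
  have tr: "transport i (side_ind s') j = side_ind s' j" for i j
    using blocks_side[of i j] by (auto simp: transport_def side_ind_def)
  have "B (\<lambda>S. N S q) S (side_ind s) (side_ind s')
      = (\<Sum>i\<in>avail S. wt i * side_ind s i *
          (\<Sum>j\<in>avail (S - {elt i}). wt j * side_ind s' j * N (S - {elt i} - {elt j}) q))"
    unfolding B_words[OF marked_finite[OF S]] tr sum_distrib_left
    by (intro sum.cong refl) (simp only: mult_ac)
  also have "\<dots> = (\<Sum>i\<in>avail S. wt i * side_ind s i * N (S - {elt i}) (q + of_bool s'))"
  proof (rule sum.cong[OF refl])
    fix i assume i: "i \<in> avail S"
    have "card (S - {elt i}) = card S - 1" using avail_elt(1)[OF i] by simp
    then have "q \<noteq> card (S - {elt i})" using q by linarith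
    from sum_side_N[OF marked_Diff[OF S i] q(1) this, of s']
    show "wt i * side_ind s i * (\<Sum>j\<in>avail (S - {elt i}). wt j * side_ind s' j * N (S - {elt i} - {elt j}) q)
      = wt i * side_ind s i * N (S - {elt i}) (q + of_bool s')" by simp
  qed
  also have "\<dots> = N S (q + of_bool s' + of_bool s)"
    using q by (intro sum_side_N[OF S]) (auto simp: of_bool_def)
  finally show ?thesis .
qed

end

theorem theorem1p35:
  fixes X :: "'a set" and r :: "'a rel" and \<omega> :: "'a \<Rightarrow> real" and z :: 'a and n k :: nat
  assumes "finite X" and "card X = n"
    and "partial_order_on X r"
    and "\<And>x. x \<in> X \<Longrightarrow> \<omega> x > 0"
    and "\<And>x y. x \<in> X \<Longrightarrow> y \<in> X \<Longrightarrow> (x, y) \<in> r \<Longrightarrow> \<omega> x \<ge> \<omega> y"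
    and "z \<in> X"
    and "1 < k" and "k < n"
  shows "(weighted_count X r \<omega> z k)\<^sup>2 \<ge>
           weighted_count X r \<omega> z (k - 1) * weighted_count X r \<omega> z (k + 1)"
proof -
  interpret marked_poset X r \<omega> z
    by (rule marked_poset.intro) (fact assms(1) assms(3) assms(4))+
  have X: "marked X" using assms(6) by (simp add: marked_def)
  \<comment> \<open>With this offset the side pairs (above, above), (above, below) and (below,
    below) give the positions \<open>k - 1\<close>, \<open>k\<close> and
    \<open>k + 1\<close>.\<close>
  define q where "q = k - 1"
  have k: "k = q + 1" and q: "1 \<le> q" "q + 2 \<le> card X" using assms by (auto simp: q_def)
  have "hyperbolic (B (\<lambda>S. N S q) X)"
    by (rule hyperbolic_N[OF assms(5) X q])
  moreover have "B (\<lambda>S. N S q) X (side_ind True) (side_ind True) \<ge> 0"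
    using N_nonneg[OF X] by (simp add: B_side_ind[OF X q])
  ultimately have "B (\<lambda>S. N S q) X (side_ind False) (side_ind False)
      * B (\<lambda>S. N S q) X (side_ind True) (side_ind True)
      \<le> (B (\<lambda>S. N S q) X (side_ind False) (side_ind True))\<^sup>2"
    unfolding hyperbolic_def by blast
  then show ?thesis by (simp add: B_side_ind[OF X q] k)
qed

end
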